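(* Assume that $\inf_{x\in D}R(x)>0$, that the sequence of positive functions $\beta_n\in\mathcal{B}(D)$, $n\ge 0$, is uniformly bounded (i.e. $\sup_n\sup_{x\in D}\beta_n(x)<\infty$) and converges uniformly on $D$, as $n\to\infty$, to a function $\beta\in\mathcal{B}(D)$ such that $\inf_{x\in D}\beta(x)>0$. Assume in addition that the function $\beta$ is continuous. Fix an arbitrary $x\in D$ and $r>0$. Let $S_m(x,r)$ be the number of those points $X_k$, $k=1,\dots,m$, that fall in the ball $B(x,rm^{-1/d})$. Then the sequence of random variables $S_m(x,r)$, $m\ge1$, converges weakly, as $m\to\infty$, to a Poisson random variable with parameter $r^d b_d\,\beta(x)/\alpha$, where $\alpha=\int_D\beta(u)\,du$ and $b_d$ is the volume of a $d$-dimensional ball of unit radius.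
   Context: Let $D\subset\mathbf{R}^d$ be a compact set of positive Lebesgue measure and let $\mathcal{B}(D)$ be the set of real-valued measurable bounded functions on $D$. Let $R:D\to\mathbf{R}_+$ be a measurable function (interaction radius). For $x\in D$ and a finite non-empty set $\mathbf{y}=\{y_1,\dots,y_n\}$ of points of $D$, $n(x,\mathbf{y})$ denotes the number of points $y_i\in\mathbf{y}$ whose distance to $x$ is not greater than $R(x)$; by definition $n(x,\emptyset)=0$. Let $\{\beta_n(x),\,n\ge 0\}$ be a sequence of measurable positive bounded functions on $D$. The random points $X_1,X_2,\dots$ in $D$ are defined sequentially on a probability space with measure $\mathsf{P}$: writing $X(k)=(X_1,\dots,X_k)$ for $k\ge1$ and $X(0)=\emptyset$, the conditional distribution of $X_{k+1}$ given $X(k)$ ($k\ge 0$) has probability density $$\psi_{k+1}(x)=\frac{\beta_{n(x,X(k))}(x)}{\alpha(X(k))},\quad x\in D,\qquad \alpha(X(k))=\int_D\beta_{n(u,X(k))}(u)\,du .$$ $B(x,\rho)$ denotes the Euclidean ball in $\mathbf{R}^d$ with centre $x$ and radius $\rho$.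
   Formalization: Instead of an arbitrary x in D, x is assumed to be a Lebesgue density point of D (true for every interior point); without this the claim fails: for D=[0,1], all β_n=1 and x=0 the limit is Poisson(r), not Poisson(2r). *)

theory Defs
  imports "HOL-Probability.Probability"
begin

text \<open>
  Functions on \<open>D\<close> are represented by total functions of which only the restriction to \<open>D\<close>
  is constrained. Measurability on \<open>D\<close> is Lebesgue measurability, which includes Borel
  measurability.
\<close>

definition bounded_measurable_on :: "'a::euclidean_space set \<Rightarrow> ('a \<Rightarrow> real) set" where
  "bounded_measurable_on D = {f. f \<in> borel_measurable (lebesgue_on D) \<and> bounded (f ` D)}"

definition num_neighbours :: "('a::euclidean_space \<Rightarrow> real) \<Rightarrow> 'a \<Rightarrow> 'a set \<Rightarrow> nat" where
  "num_neighbours R x Y = card {y \<in> Y. dist x y \<le> R x}"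

definition normalizer ::
    "'a::euclidean_space set \<Rightarrow> ('a \<Rightarrow> real) \<Rightarrow> (nat \<Rightarrow> 'a \<Rightarrow> real) \<Rightarrow> 'a set \<Rightarrow> real" where
  "normalizer D R \<beta> Y = (LINT u:D|lebesgue. \<beta> (num_neighbours R u Y) u)"

definition next_density ::
    "'a::euclidean_space set \<Rightarrow> ('a \<Rightarrow> real) \<Rightarrow> (nat \<Rightarrow> 'a \<Rightarrow> real) \<Rightarrow> 'a set \<Rightarrow> 'a \<Rightarrow> real" where
  "next_density D R \<beta> Y x = \<beta> (num_neighbours R x Y) x / normalizer D R \<beta> Y"

text \<open>
  The sigma-algebra generated by \<open>(X 1, \<dots>, X k)\<close>; for \<open>k = 0\<close> it is the trivial one.
\<close>

definition history :: "'w measure \<Rightarrow> (nat \<Rightarrow> 'w \<Rightarrow> 'a::euclidean_space) \<Rightarrow> nat \<Rightarrow> 'w measure" where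
  "history M X k =
     vimage_algebra (space M) (\<lambda>\<omega>. \<lambda>i\<in>{1..k}. X i \<omega>) (Pi\<^sub>M {1..k} (\<lambda>_. borel))"

text \<open>
  The points are \<open>X 1, X 2, \<dots>\<close>; the value \<open>X 0\<close> is not used. The last clause says that, for every
  \<open>k \<ge> 0\<close>, the conditional distribution of \<open>X (k + 1)\<close> given \<open>(X 1, \<dots>, X k)\<close> has the density
  \<open>next_density\<close> on \<open>D\<close>.
\<close>

definition sequential_points ::
    "'w measure \<Rightarrow> 'a::euclidean_space set \<Rightarrow> ('a \<Rightarrow> real) \<Rightarrow> (nat \<Rightarrow> 'a \<Rightarrow> real)
      \<Rightarrow> (nat \<Rightarrow> 'w \<Rightarrow> 'a) \<Rightarrow> bool" where
  "sequential_points M D R \<beta> X \<longleftrightarrow>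
     prob_space M \<and>
     (\<forall>k\<ge>1. X k \<in> measurable M (restrict_space borel D)) \<and>
     (\<forall>k. \<forall>A\<in>sets borel.
        AE \<omega> in M.
          real_cond_exp M (history M X k) (\<lambda>\<omega>'. indicator A (X (Suc k) \<omega>')) \<omega> =
            (LINT u:A \<inter> D|lebesgue. next_density D R \<beta> ((\<lambda>i. X i \<omega>) ` {1..k}) u))"

definition count_in_ball ::
    "(nat \<Rightarrow> 'w \<Rightarrow> 'a::euclidean_space) \<Rightarrow> 'a \<Rightarrow> real \<Rightarrow> nat \<Rightarrow> 'w \<Rightarrow> nat" where
  "count_in_ball X x r m \<omega> =
     card {k \<in> {1..m}. X k \<omega> \<in> cball x (r * real m powr (- 1 / real DIM('a)))}"

text \<open>
  The limit parameter \<open>r\<^sup>d b\<^sub>d \<beta>(x) / \<alpha>\<close> contains the volume of the whole ball around \<open>x\<close>, so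
  \<open>D\<close> has to fill small balls around \<open>x\<close> asymptotically. This holds for every interior point
  (see below) but can fail on the boundary: for \<open>D = [0,1]\<close> and all \<open>\<beta>\<^sub>n = 1\<close>, the limit at
  \<open>x = 0\<close> is Poisson with parameter \<open>r\<close>, not \<open>2 r\<close>.
\<close>

definition density_point :: "'a::euclidean_space set \<Rightarrow> 'a \<Rightarrow> bool" where
  "density_point D x \<longleftrightarrow>
     ((\<lambda>\<rho>. measure lebesgue (D \<inter> cball x \<rho>) / measure lebesgue (cball x \<rho>)) \<longlongrightarrow> 1) (at_right 0)"

lemma interior_imp_density_point:
  fixes x :: "'a::euclidean_space"
  assumes "x \<in> interior D"
  shows "density_point D x"
proof -
  obtain e where e: "e > 0" "cball x e \<subseteq> D"
    using assms mem_interior_cball by blast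
  have *: "measure lebesgue (D \<inter> cball x \<rho>) / measure lebesgue (cball x \<rho>) = 1"
    if "0 < \<rho>" "\<rho> < e" for \<rho>
  proof -
    have "cball x \<rho> \<subseteq> cball x e"
      using that by (intro subset_cball) simp
    then have "D \<inter> cball x \<rho> = cball x \<rho>"
      using e by blast
    moreover have "measure lebesgue (cball x \<rho>) > 0"
      using content_cball_gt_0_iff[of x \<rho>] that by simp
    ultimately show ?thesis
      by simp
  qed
  have "\<forall>\<^sub>F \<rho> in at_right 0. measure lebesgue (D \<inter> cball x \<rho>) / measure lebesgue (cball x \<rho>) = 1"
    unfolding eventually_at_right_field using e * by auto
  then show ?thesis
    unfolding density_point_def by (rule tendsto_eventually)
qed

end

theory Submission
  imports Defs
begin

text \<open>
  Let \<open>p\<^sub>k\<close> be the conditional probability, given the first \<open>k\<close> points, that the next one falls into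
  the ball of radius \<open>r m powr (- 1 / d)\<close>. The probabilities of the values of the counting variable
  satisfy the recursion of binomial probabilities, with \<open>p\<^sub>k\<close> in the role of the success probability.
  Replacing each \<open>p\<^sub>k\<close> by the constant \<open>\<lambda> / m\<close> changes them by at most twice the sum over \<open>k < m\<close> of
  the expectations of \<open>\<bar>p\<^sub>k - \<lambda> / m\<bar>\<close>, so it suffices that this sum tends to \<open>0\<close>; the rest is the
  Poisson limit of the binomial distribution.

  The next density is uniformly close to \<open>\<beta> / \<alpha>\<close> as soon as almost every point of \<open>D\<close> has many
  neighbours. For this it is enough that each set of a suitable finite family of sets of positive
  measure has been hit. In each step such a set is hit with conditional probability bounded away
  from \<open>0\<close>, so the probability that one of them is still missed after \<open>k\<close> steps decays
  geometrically, and the total error is \<open>O(\<epsilon>) + O(1 / m)\<close> for every \<open>\<epsilon> > 0\<close>.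
\<close>

section \<open>Weak convergence of integer-valued random variables\<close>

text \<open>The distribution function at \<open>y\<close> sums the point probabilities over the
  finitely many \<open>j\<close> with \<open>real j \<le> y\<close>, so it converges at every
  \<open>y\<close>, in particular at the continuity points of the limit.\<close>

lemma weak_conv_m_of_nat_pointwise:
  fixes S :: "nat \<Rightarrow> 'w \<Rightarrow> nat" and p :: "nat pmf"
  assumes "prob_space M"
    and S: "\<And>m. S m \<in> measurable M (count_space UNIV)"
    and lim: "\<And>j. (\<lambda>m. measure M {\<omega> \<in> space M. S m \<omega> = j}) \<longlonglongrightarrow> pmf p j"
  shows "weak_conv_m (\<lambda>m. distr M borel (\<lambda>\<omega>. real (S m \<omega>))) (distr (measure_pmf p) borel real)"
proof -
  interpret prob_space M by fact
  note S [measurable]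
  have "(\<lambda>m. cdf (distr M borel (\<lambda>\<omega>. real (S m \<omega>))) y)
          \<longlonglongrightarrow> cdf (distr (measure_pmf p) borel real) y" for y :: real
  proof -
    define J where "J = {j. real j \<le> y}"
    have "J \<subseteq> {..nat \<lfloor>y\<rfloor>}"
      unfolding J_def by (auto simp: le_nat_floor)
    then have J: "finite J"
      using finite_subset by blast
    have "cdf (distr M borel (\<lambda>\<omega>. real (S m \<omega>))) y
            = (\<Sum>j\<in>J. measure M {\<omega> \<in> space M. S m \<omega> = j})" for m
    proof -
      have "cdf (distr M borel (\<lambda>\<omega>. real (S m \<omega>))) y = measure M {\<omega> \<in> space M. real (S m \<omega>) \<le> y}"
        unfolding cdf_def by (subst measure_distr) (auto intro!: arg_cong[where f = "measure M"])
      also have "{\<omega> \<in> space M. real (S m \<omega>) \<le> y} = (\<Union>j\<in>J. {\<omega> \<in> space M. S m \<omega> = j})"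
        by (auto simp: J_def)
      also have "measure M \<dots> = (\<Sum>j\<in>J. measure M {\<omega> \<in> space M. S m \<omega> = j})"
        by (rule finite_measure_finite_Union) (use J in \<open>auto simp: disjoint_family_on_def\<close>)
      finally show ?thesis .
    qed
    moreover have "cdf (distr (measure_pmf p) borel real) y = (\<Sum>j\<in>J. pmf p j)"
    proof -
      have "cdf (distr (measure_pmf p) borel real) y = measure (measure_pmf p) J"
        unfolding cdf_def J_def by (subst measure_distr) (auto intro!: arg_cong[where f = "measure_pmf.prob p"])
      then show ?thesis
        using J by (simp add: measure_measure_pmf_finite)
    qed
    ultimately show ?thesis
      using lim by (auto intro!: tendsto_sum)
  qed
  then show ?thesis
    by (simp add: weak_conv_m_def weak_conv_def)
qed

section \<open>Binomial probabilities: stability of the recursion and the Poisson limit\<close>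

text \<open>Pascal's rule, read as conditioning on the last of \<open>Suc k\<close> independent
  trials with success probability \<open>q\<close>.\<close>

lemma binomial_probability_Suc_Suc:
  fixes q :: real
  shows "real (Suc k choose Suc j) * q ^ Suc j * (1 - q) ^ (Suc k - Suc j)
    = (1 - q) * (real (k choose Suc j) * q ^ Suc j * (1 - q) ^ (k - Suc j))
      + q * (real (k choose j) * q ^ j * (1 - q) ^ (k - j))"
proof (cases "Suc j \<le> k")
  case True
  then have "k - j = Suc (k - Suc j)" by simp
  then show ?thesis by (simp add: algebra_simps)
next
  \<comment> \<open>Here \<open>k \<le> j\<close>, so \<open>k choose Suc j\<close> is
    \<open>0\<close> and all truncated exponents of \<open>1 - q\<close> are
    \<open>0\<close>.\<close>
  case False
  then show ?thesis by (simp add: binomial_eq_0 algebra_simps)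
qed

text \<open>One step of the exact recursion averages with weights \<open>1 - q\<close> and
  \<open>q\<close>. It does not enlarge the largest error of the previous row, so the defects
  \<open>e k\<close> merely add up.\<close>

lemma perturbed_binomial_recursion:
  fixes a :: "nat \<Rightarrow> nat \<Rightarrow> real" and q :: real and e :: "nat \<Rightarrow> real"
  assumes q: "0 \<le> q" "q \<le> 1"
    and init: "\<And>j. a 0 j = (if j = 0 then 1 else 0)"
    and zero: "\<And>k. \<bar>a (Suc k) 0 - (1 - q) * a k 0\<bar> \<le> e k"
    and step: "\<And>k j. \<bar>a (Suc k) (Suc j) - ((1 - q) * a k (Suc j) + q * a k j)\<bar> \<le> e k"
  shows "\<bar>a m j - real (m choose j) * q ^ j * (1 - q) ^ (m - j)\<bar> \<le> (\<Sum>k<m. e k)"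
proof (induction m arbitrary: j)
  case 0
  show ?case by (cases j) (auto simp: init)
next
  case (Suc m)
  define b where "b k j = real (k choose j) * q ^ j * (1 - q) ^ (k - j)" for k j
  have IH: "\<bar>a m j - b m j\<bar> \<le> (\<Sum>k<m. e k)" for j
    using Suc.IH[of j] by (simp add: b_def)
  have *: "\<bar>(1 - q) * (a m j - b m j)\<bar> \<le> (1 - q) * (\<Sum>k<m. e k)" for j
    using q IH[of j] by (simp add: abs_mult mult_left_mono)
  have **: "\<bar>q * (a m j - b m j)\<bar> \<le> q * (\<Sum>k<m. e k)" for j
    using q IH[of j] by (simp add: abs_mult mult_left_mono)
  show ?case
  proof (cases j)
    case 0
    have "b (Suc m) 0 = (1 - q) * b m 0"
      by (simp add: b_def)
    then have "a (Suc m) 0 - b (Suc m) 0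
        = (a (Suc m) 0 - (1 - q) * a m 0) + (1 - q) * (a m 0 - b m 0)"
      by (simp add: algebra_simps)
    \<comment> \<open>By the induction hypothesis the sum dominates an absolute value, so it is
      nonnegative and does not grow under the factor \<open>1 - q\<close>.\<close>
    moreover have "0 \<le> (\<Sum>k<m. e k)"
      using IH[of 0] by linarith
    then have "(1 - q) * (\<Sum>k<m. e k) \<le> (\<Sum>k<m. e k)"
      using q by (simp add: mult_left_le_one_le)
    ultimately have "\<bar>a (Suc m) 0 - b (Suc m) 0\<bar> \<le> (\<Sum>k<Suc m. e k)"
      using zero[of m] *[of 0] by simp
    then show ?thesis
      using 0 by (simp add: b_def)
  next
    case (Suc i)
    have "b (Suc m) (Suc i) = (1 - q) * b m (Suc i) + q * b m i"
      unfolding b_def by (rule binomial_probability_Suc_Suc)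
    then have "a (Suc m) (Suc i) - b (Suc m) (Suc i)
        = (a (Suc m) (Suc i) - ((1 - q) * a m (Suc i) + q * a m i))
          + (1 - q) * (a m (Suc i) - b m (Suc i)) + q * (a m i - b m i)"
      by (simp add: algebra_simps)
    moreover have "(1 - q) * (\<Sum>k<m. e k) + q * (\<Sum>k<m. e k) = (\<Sum>k<m. e k)"
      by (simp add: algebra_simps)
    ultimately have "\<bar>a (Suc m) (Suc i) - b (Suc m) (Suc i)\<bar> \<le> (\<Sum>k<Suc m. e k)"
      using step[of m i] *[of "Suc i"] **[of i] by simp
    then show ?thesis
      using Suc by (simp add: b_def)
  qed
qed

text \<open>The probability factors into \<open>real (m choose j) / real m ^ j\<close>, which tends
  to \<open>1 / fact j\<close> by induction on \<open>j\<close>, the constant \<open>l ^ j\<close>,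
  and \<open>(1 - l / real m) ^ m / (1 - l / real m) ^ j\<close>, whose numerator tends to
  \<open>exp (- l)\<close> and whose denominator tends to \<open>1\<close>.\<close>

lemma poisson_limit_of_binomial:
  fixes l :: real
  shows "(\<lambda>m. real (m choose j) * (l / real m) ^ j * (1 - l / real m) ^ (m - j))
           \<longlonglongrightarrow> l ^ j / fact j * exp (- l)"
proof -
  have choose: "(\<lambda>m. real (m choose j) / real m ^ j) \<longlonglongrightarrow> 1 / fact j"
  proof (induction j)
    case (Suc j)
    have "(\<lambda>m. real (m choose j) / real m ^ j * ((1 - real j / real m) / real (Suc j)))
        \<longlonglongrightarrow> 1 / fact j * ((1 - 0) / real (Suc j))"
      by (intro tendsto_intros Suc lim_const_over_n) auto
    moreover have "\<forall>\<^sub>F m in sequentially. real (m choose j) / real m ^ j * ((1 - real j / real m) / real (Suc j))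
        = real (m choose Suc j) / real m ^ Suc j"
      using eventually_gt_at_top[of j]
    proof eventually_elim
      case (elim m)
      have "Suc j * (m choose Suc j) = (m - j) * (m choose j)"
        using binomial_absorb_comp[of m j] binomial_absorption[of j m] by simp
      then have "real (Suc j) * real (m choose Suc j) = real (m - j) * real (m choose j)"
        by (metis of_nat_mult)
      then have "real (m choose Suc j) = real (m - j) * real (m choose j) / real (Suc j)"
        by (simp add: field_simps)
      moreover have "real (m - j) = real m - real j"
        using elim by simp
      ultimately show ?case
        using elim by (simp add: divide_simps del: of_nat_Suc)
    qed
    ultimately show ?case
      by (auto intro: Lim_transform_eventually simp: field_simps)
  qed simp
  have "(\<lambda>m. (1 + (- l) / real m) ^ m) \<longlonglongrightarrow> exp (- l)"
    by (rule tendsto_exp_limit_sequentially)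
  moreover have "(\<lambda>m. (1 - l / real m) ^ j) \<longlonglongrightarrow> (1 - 0) ^ j"
    by (intro tendsto_intros lim_const_over_n)
  ultimately have "(\<lambda>m. real (m choose j) / real m ^ j * l ^ j
        * ((1 + (- l) / real m) ^ m / (1 - l / real m) ^ j))
      \<longlonglongrightarrow> 1 / fact j * l ^ j * (exp (- l) / (1 - 0) ^ j)"
    by (intro tendsto_intros choose) auto
  moreover have "\<forall>\<^sub>F m in sequentially. real (m choose j) / real m ^ j * l ^ j
        * ((1 + (- l) / real m) ^ m / (1 - l / real m) ^ j)
      = real (m choose j) * (l / real m) ^ j * (1 - l / real m) ^ (m - j)"
    \<comment> \<open>Beyond this threshold \<open>m - j\<close> is a genuine difference and
      \<open>1 - l / real m\<close> is nonzero, so the power may be divided out.\<close>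
    using eventually_gt_at_top[of "max j (nat \<lceil>\<bar>l\<bar>\<rceil>)"]
  proof eventually_elim
    case (elim m)
    then have "m > j" "real m > \<bar>l\<bar>"
      by linarith+
    then have "1 - l / real m \<noteq> 0"
      by (auto simp: divide_simps)
    then have "(1 - l / real m) ^ (m - j) = (1 - l / real m) ^ m / (1 - l / real m) ^ j"
      using \<open>m > j\<close> by (simp add: power_diff)
    then show ?case
      by (simp add: power_divide)
  qed
  ultimately show ?thesis
    by (auto intro: Lim_transform_eventually simp: mult.commute)
qed

section \<open>Finite hitting families built from pieces of positive measure\<close>

text \<open>Lebesgue measure has no atoms. Finitely many balls of volume smaller than that of
  \<open>S\<close> cover \<open>S\<close>; one of them meets \<open>S\<close> in positive measure,
  and being too small it also leaves positive measure behind.\<close>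

lemma split_positive_measure:
  fixes S :: "'a::euclidean_space set"
  assumes S: "S \<in> lmeasurable" and bdd: "bounded S" and pos: "measure lebesgue S > 0"
  obtains A where "A \<in> sets borel" "measure lebesgue (S \<inter> A) > 0" "measure lebesgue (S - A) > 0"
proof -
  define V where "V = unit_ball_vol (real DIM('a))"
  have "V > 0"
    by (simp add: V_def)
  \<comment> \<open>With \<open>s \<le> 1\<close> the volume \<open>V * s ^ DIM('a)\<close> of a
    ball of radius \<open>s\<close> is at most \<open>V * s\<close>, and the second bound keeps this
    at most half the measure of \<open>S\<close>.\<close>
  define s where "s = min 1 (measure lebesgue S / (2 * V))"
  have s: "0 < s" "s \<le> 1" "s * V < measure lebesgue S"
    using pos \<open>V > 0\<close> by (auto simp: s_def min_def field_simps)
  have small: "measure lebesgue (cball c s) < measure lebesgue S" for c :: 'a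
  proof -
    have "measure lebesgue (cball c s) = V * s ^ DIM('a)"
      using s content_cball[of s c] by (simp add: V_def)
    also have "s ^ DIM('a) \<le> s ^ 1"
      using s by (intro power_decreasing) (auto simp: Suc_le_eq)
    finally show ?thesis
      using s \<open>V > 0\<close> by (simp add: mult.commute mult_left_mono)
  qed
  have "compact (closure S)"
    using bdd by (simp add: compact_closure)
  then obtain K where K: "finite K" "S \<subseteq> (\<Union>c\<in>K. cball c s)"
  proof (rule compactE_image[of "closure S" "closure S" "\<lambda>c. ball c s"])
    show "closure S \<subseteq> (\<Union>c\<in>closure S. ball c s)"
      using s by auto
  next
    fix C assume "C \<subseteq> closure S" "finite C" "closure S \<subseteq> (\<Union>c\<in>C. ball c s)"
    then have "S \<subseteq> (\<Union>c\<in>C. cball c s)"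
      using closure_subset[of S] ball_subset_cball[of _ s] by (meson UN_mono order_refl order_trans)
    then show ?thesis
      using that \<open>finite C\<close> by blast
  qed auto
  have "\<exists>c\<in>K. measure lebesgue (S \<inter> cball c s) > 0"
  proof (rule ccontr)
    assume "\<not> ?thesis"
    then have "measure lebesgue (S \<inter> cball c s) = 0" if "c \<in> K" for c
      using that measure_nonneg[of lebesgue "S \<inter> cball c s"] by (metis less_eq_real_def)
    then have "negligible (S \<inter> cball c s)" if "c \<in> K" for c
      using that S by (simp add: negligible_iff_measure fmeasurable.Int)
    then have "negligible (\<Union>c\<in>K. S \<inter> cball c s)"
      using K by (intro negligible_Union) auto
    moreover have "S = (\<Union>c\<in>K. S \<inter> cball c s)"
      using K by auto
    ultimately show False
      using pos negligible_imp_measure0 by fastforce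
  qed
  then obtain c where c: "measure lebesgue (S \<inter> cball c s) > 0"
    by blast
  have "measure lebesgue (S - S \<inter> cball c s) = measure lebesgue S - measure lebesgue (S \<inter> cball c s)"
    using S by (intro measurable_measure_Diff) auto
  moreover have "S - S \<inter> cball c s = S - cball c s"
    by auto
  moreover have "measure lebesgue (S \<inter> cball c s) \<le> measure lebesgue (cball c s)"
    using S by (intro measure_mono_fmeasurable) auto
  ultimately have "measure lebesgue (S - cball c s) > 0"
    using small[of c] by simp
  then show ?thesis
    using that[of "cball c s"] c by auto
qed

text \<open>Split off one piece \<open>A\<close> and treat the remainder \<open>S - A\<close> by
  induction.\<close>

lemma split_positive_measure_disjoint:
  fixes S :: "'a::euclidean_space set"
  assumes "S \<in> lmeasurable" "bounded S" "measure lebesgue S > 0"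
  shows "\<exists>P :: nat \<Rightarrow> 'a set. (\<forall>i<n. P i \<in> sets borel \<and> measure lebesgue (S \<inter> P i) > 0)
    \<and> disjoint_family_on P {..<n}"
  using assms
proof (induction n arbitrary: S)
  case 0
  then show ?case by (auto simp: disjoint_family_on_def)
next
  case (Suc n)
  obtain A where A: "A \<in> sets borel" "measure lebesgue (S \<inter> A) > 0" "measure lebesgue (S - A) > 0"
    using split_positive_measure Suc.prems by blast
  have "A \<in> sets lebesgue"
    using A(1) by simp
  then have "S - A \<in> lmeasurable" "bounded (S - A)"
    using Suc.prems by (auto intro: fmeasurable.Diff bounded_subset fmeasurable_Diff)
  then obtain P :: "nat \<Rightarrow> 'a set" where P: "\<And>i. i < n \<Longrightarrow> P i \<in> sets borel"
    "\<And>i. i < n \<Longrightarrow> measure lebesgue ((S - A) \<inter> P i) > 0" "disjoint_family_on P {..<n}"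
    using Suc.IH[of "S - A"] A(3) by blast
  \<comment> \<open>Removing \<open>A\<close> makes the inductive pieces disjoint from the new piece
    and leaves their traces on \<open>S - A\<close> unchanged.\<close>
  define Q where "Q i = (if i < n then P i - A else A)" for i
  have "S \<inter> Q i = (S - A) \<inter> P i" if "i < n" for i
    using that by (auto simp: Q_def)
  moreover have "S \<inter> Q i = S \<inter> A" if "\<not> i < n" for i
    using that by (simp add: Q_def)
  ultimately have "measure lebesgue (S \<inter> Q i) > 0" for i
    using P(2) A(2) by (cases "i < n") auto
  moreover have "Q i \<in> sets borel" for i
    using P(1) A(1) by (auto simp: Q_def)
  moreover have "disjoint_family_on Q {..<Suc n}"
    using P(3) by (auto simp: disjoint_family_on_def Q_def less_Suc_eq)
  ultimately show ?case
    by blast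
qed

text \<open>
  Every member of a small cell is within distance \<open>\<rho>\<close> of every point of that cell, so hitting
  \<open>n\<close> disjoint pieces of the cell provides \<open>n\<close> \<^emph>\<open>distinct\<close> neighbours at once. This makes it
  unnecessary to know that the random points are almost surely distinct.
\<close>

lemma finite_hitting_family:
  fixes D :: "'a::euclidean_space set"
  assumes D: "compact D" and \<rho>: "\<rho> > 0"
  obtains F N where "finite F" "\<And>P. P \<in> F \<Longrightarrow> P \<in> sets borel"
    "\<And>P. P \<in> F \<Longrightarrow> measure lebesgue (P \<inter> D) > 0" "N \<in> null_sets lebesgue"
    "\<And>Y u. finite Y \<Longrightarrow> (\<And>P. P \<in> F \<Longrightarrow> P \<inter> Y \<noteq> {}) \<Longrightarrow> u \<in> D - N
      \<Longrightarrow> n \<le> card {y \<in> Y. dist u y \<le> \<rho>}"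
proof -
  \<comment> \<open>Half the radius: two points of one cell are then at distance at most
    \<open>\<rho>\<close>.\<close>
  define B where "B c = cball c (\<rho> / 2)" for c :: 'a
  obtain K where K: "finite K" "D \<subseteq> (\<Union>c\<in>K. B c)"
  proof (rule compactE_image[OF D, of D "\<lambda>c. ball c (\<rho> / 2)"])
    show "D \<subseteq> (\<Union>c\<in>D. ball c (\<rho> / 2))"
      using \<rho> by auto
  next
    fix C assume "C \<subseteq> D" "finite C" "D \<subseteq> (\<Union>c\<in>C. ball c (\<rho> / 2))"
    then have "D \<subseteq> (\<Union>c\<in>C. B c)"
      using ball_subset_cball[of _ "\<rho> / 2"] unfolding B_def by (meson UN_mono order_refl order_trans)
    then show ?thesis
      using that \<open>finite C\<close> by blast
  qed auto
  \<comment> \<open>Only cells that meet \<open>D\<close> in positive measure can be cut into pieces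
    of positive measure. The traces of the other cells on \<open>D\<close> form the exceptional null
    set \<open>N\<close>.\<close>
  define L where "L = {c \<in> K. measure lebesgue (D \<inter> B c) > 0}"
  have DB: "D \<inter> B c \<in> lmeasurable" "bounded (D \<inter> B c)" for c
    using D compact_imp_bounded
    by (auto simp: B_def intro!: fmeasurable.Int lmeasurable_compact bounded_Int)
  have "\<exists>P :: nat \<Rightarrow> 'a set. (\<forall>i<n. P i \<in> sets borel \<and> measure lebesgue ((D \<inter> B c) \<inter> P i) > 0)
      \<and> disjoint_family_on P {..<n}" if "c \<in> L" for c
    using that DB[of c] by (intro split_positive_measure_disjoint) (auto simp: L_def)
  then obtain P :: "'a \<Rightarrow> nat \<Rightarrow> 'a set" where P: "\<And>c i. c \<in> L \<Longrightarrow> i < n \<Longrightarrow> P c i \<in> sets borel"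
    "\<And>c i. c \<in> L \<Longrightarrow> i < n \<Longrightarrow> measure lebesgue ((D \<inter> B c) \<inter> P c i) > 0"
    "\<And>c. c \<in> L \<Longrightarrow> disjoint_family_on (P c) {..<n}"
    by metis
  define F where "F = (\<lambda>(c, i). P c i \<inter> B c) ` (L \<times> {..<n})"
  define N where "N = (\<Union>c\<in>K - L. D \<inter> B c)"
  show ?thesis
  proof (rule that[of F N])
    show "finite F"
      using K by (auto simp: F_def L_def)
    show "A \<in> sets borel" if "A \<in> F" for A
      using that P(1) by (auto simp: F_def B_def)
    show "measure lebesgue (A \<inter> D) > 0" if "A \<in> F" for A
    proof -
      obtain c i where "A = P c i \<inter> B c" "c \<in> L" "i < n"
        using \<open>A \<in> F\<close> by (auto simp: F_def)
      moreover have "P c i \<inter> B c \<inter> D = (D \<inter> B c) \<inter> P c i"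
        by auto
      ultimately show ?thesis
        using P(2)[of c i] by simp
    qed
    have "negligible (D \<inter> B c)" if "c \<in> K - L" for c
      using that DB(1)[of c] measure_nonneg[of lebesgue "D \<inter> B c"]
      by (auto simp: negligible_iff_measure L_def not_less intro: antisym)
    then have "negligible N"
      unfolding N_def using K by (intro negligible_Union) auto
    then show "N \<in> null_sets lebesgue"
      by (simp add: negligible_iff_null_sets)
    show "n \<le> card {y \<in> Y. dist u y \<le> \<rho>}"
      if Y: "finite Y" and hit: "\<And>A. A \<in> F \<Longrightarrow> A \<inter> Y \<noteq> {}" and u: "u \<in> D - N" for Y u
    proof -
      obtain c where c: "c \<in> K" "u \<in> B c"
        using K u by auto
      then have "c \<in> L"
        using u by (auto simp: N_def)
      then have "P c i \<inter> B c \<in> F" if "i < n" for i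
        using that by (auto simp: F_def)
      then have "\<exists>y. y \<in> P c i \<inter> B c \<inter> Y" if "i < n" for i
        using hit that by blast
      then obtain y where y: "\<And>i. i < n \<Longrightarrow> y i \<in> P c i \<inter> B c \<inter> Y"
        by metis
      have "inj_on y {..<n}"
      proof (rule inj_onI)
        fix i j assume "i \<in> {..<n}" "j \<in> {..<n}" "y i = y j"
        then show "i = j"
          using P(3)[OF \<open>c \<in> L\<close>] y[of i] y[of j] by (auto simp: disjoint_family_on_def)
      qed
      moreover have "dist u v \<le> \<rho>" if "v \<in> B c" for v
        using that c(2) dist_triangle2[of u v c] by (simp add: B_def dist_commute)
      then have "y ` {..<n} \<subseteq> {y \<in> Y. dist u y \<le> \<rho>}"
        using y by auto
      ultimately show ?thesis
        using Y card_mono[of "{y \<in> Y. dist u y \<le> \<rho>}" "y ` {..<n}"] by (simp add: card_image)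
    qed
  qed
qed

section \<open>Lebesgue set integrals and measurability of the neighbour count\<close>

lemma set_integrable_bounded_on:
  fixes h :: "'a::euclidean_space \<Rightarrow> real"
  assumes h: "h \<in> borel_measurable (lebesgue_on D)" and D: "D \<in> lmeasurable"
    and A: "A \<in> sets lebesgue" and bnd: "\<And>u. u \<in> D \<Longrightarrow> \<bar>h u\<bar> \<le> B"
  shows "set_integrable lebesgue (A \<inter> D) h"
proof -
  have meas: "(\<lambda>u. indicator D u *\<^sub>R h u) \<in> borel_measurable lebesgue"
    using h D by (simp add: borel_measurable_restrict_space_iff)
  have "(\<lambda>u. indicator A u *\<^sub>R (indicator D u *\<^sub>R h u)) \<in> borel_measurable lebesgue"
    using A meas by measurable
  then have "set_borel_measurable lebesgue (A \<inter> D) h"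
    by (simp add: set_borel_measurable_def indicator_inter_arith mult.assoc)
  moreover have "integrable lebesgue (\<lambda>u. B * indicator D u)"
    using D by (auto simp: fmeasurable_def)
  ultimately show ?thesis
    unfolding set_integrable_def set_borel_measurable_def
  proof (elim Bochner_Integration.integrable_bound[rotated])
    show "AE u in lebesgue. norm (indicator (A \<inter> D) u *\<^sub>R h u) \<le> norm (B * indicator D u)"
      using bnd by (force simp: indicator_def)
  qed
qed

lemma set_integral_const_lmeasurable:
  fixes c :: real
  assumes "S \<in> lmeasurable"
  shows "set_integrable lebesgue S (\<lambda>_. c)" "(LINT u:S|lebesgue. c) = c * measure lebesgue S"
  using assms by (auto simp: set_integrable_def set_lebesgue_integral_def fmeasurable_def)

lemma set_integral_diff_bound_AE:
  fixes f h :: "'a::euclidean_space \<Rightarrow> real"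
  assumes "S \<in> lmeasurable" "set_integrable lebesgue S f" "set_integrable lebesgue S h"
    and "AE u in lebesgue. u \<in> S \<longrightarrow> \<bar>f u - h u\<bar> \<le> B"
  shows "\<bar>(LINT u:S|lebesgue. f u) - (LINT u:S|lebesgue. h u)\<bar> \<le> B * measure lebesgue S"
proof -
  have fh: "set_integrable lebesgue S (\<lambda>u. f u - h u)"
    using assms by (intro set_integral_diff)
  have "\<bar>(LINT u:S|lebesgue. f u) - (LINT u:S|lebesgue. h u)\<bar> = \<bar>LINT u:S|lebesgue. f u - h u\<bar>"
    using assms by (simp add: set_integral_diff)
  also have "\<dots> \<le> (LINT u:S|lebesgue. \<bar>f u - h u\<bar>)"
    using set_integral_norm_bound[OF fh] by simp
  also have "\<dots> \<le> (LINT u:S|lebesgue. B)"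
    using assms(4) fh
    by (intro set_integral_mono_AE set_integral_const_lmeasurable assms(1) set_integrable_abs) auto
  finally show ?thesis
    using assms(1) by (simp add: set_integral_const_lmeasurable)
qed

lemma set_integral_positive:
  fixes f :: "'a::euclidean_space \<Rightarrow> real"
  assumes f: "set_integrable lebesgue S f" and S: "S \<in> sets lebesgue"
    and pos: "\<And>u. u \<in> S \<Longrightarrow> f u > 0" and meas: "measure lebesgue S > 0"
  shows "(LINT u:S|lebesgue. f u) > 0"
proof -
  have nn: "AE u in lebesgue. 0 \<le> indicator S u *\<^sub>R f u"
    using pos by (auto simp: indicator_def less_imp_le)
  have "(LINT u:S|lebesgue. f u) \<ge> 0"
    unfolding set_lebesgue_integral_def using nn by (rule integral_nonneg_AE)
  moreover have "(LINT u:S|lebesgue. f u) \<noteq> 0"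
  proof
    assume "(LINT u:S|lebesgue. f u) = 0"
    then have "AE u in lebesgue. indicator S u *\<^sub>R f u = 0"
      using f nn by (simp add: set_lebesgue_integral_def set_integrable_def integral_nonneg_eq_0_iff_AE)
    then have "AE u in lebesgue. u \<notin> S"
      by eventually_elim (use pos in \<open>force simp: indicator_def\<close>)
    then have "S \<in> null_sets lebesgue"
      using S by (simp add: AE_iff_null_sets)
    then show False
      using meas by (simp add: measure_eq_0_null_sets)
  qed
  ultimately show ?thesis
    by simp
qed

lemma num_neighbours_measurable:
  assumes R: "R \<in> borel_measurable (lebesgue_on D)" and "D \<in> sets lebesgue" and Y: "finite Y"
  shows "(\<lambda>u. num_neighbours R u Y) \<in> measurable (lebesgue_on D) (count_space UNIV)"
proof -
  have "(\<lambda>u. dist u y) \<in> borel_measurable (lebesgue_on D)" for y :: 'a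
    by (intro measurable_restrict_space1 measurable_completion) measurable
  note [measurable] = this R
  have "num_neighbours R u Y = (\<Sum>y\<in>Y. if dist u y \<le> R u then 1 else 0)" for u
    using Y by (simp add: num_neighbours_def sum.If_cases Int_def)
  moreover have "(\<lambda>u. \<Sum>y\<in>Y. if dist u y \<le> R u then 1 else (0::nat))
      \<in> measurable (lebesgue_on D) (count_space UNIV)"
    by measurable
  ultimately show ?thesis
    by simp
qed

section \<open>The history sigma-algebra\<close>

lemma subalgebra_history:
  assumes "\<And>i. i \<ge> 1 \<Longrightarrow> X i \<in> measurable M borel"
  shows "subalgebra M (history M X k)"
proof -
  have "(\<lambda>\<omega>. \<lambda>i\<in>{1..k}. X i \<omega>) \<in> measurable M (Pi\<^sub>M {1..k} (\<lambda>_. borel))"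
    using assms by (intro measurable_restrict) auto
  then have "sets (history M X k) \<subseteq> sets M"
    unfolding history_def by (subst sets_vimage_algebra2) (auto simp: space_PiM intro: measurable_sets)
  then show ?thesis
    by (simp add: subalgebra_def history_def)
qed

lemma measurable_history:
  assumes "1 \<le> i" "i \<le> k"
  shows "X i \<in> measurable (history M X k) borel"
proof -
  have "(\<lambda>\<omega>. \<lambda>i\<in>{1..k}. X i \<omega>) \<in> measurable (history M X k) (Pi\<^sub>M {1..k} (\<lambda>_. borel))"
    unfolding history_def by (rule measurable_vimage_algebra1) (auto simp: space_PiM)
  from measurable_compose[OF this measurable_component_singleton[of i]]
  have "(\<lambda>\<omega>. (\<lambda>i\<in>{1..k}. X i \<omega>) i) \<in> measurable (history M X k) borel"
    using assms by simp
  then show ?thesis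
    using assms by simp
qed

section \<open>Uniform bounds on densities and hitting probabilities\<close>

text \<open>The parameters \<open>\<rho>\<close>, \<open>C\<close> and \<open>c\<close> turn the
  assumptions into plain pointwise bounds; the theorem takes infima for \<open>\<rho>\<close> and
  \<open>c\<close> and a common upper bound of the \<open>\<beta> n\<close> for
  \<open>C\<close>.\<close>

locale growing_points = prob_space M
  for M :: "'w measure" and D :: "'a::euclidean_space set" and R :: "'a \<Rightarrow> real"
    and \<beta> :: "nat \<Rightarrow> 'a \<Rightarrow> real" and \<beta>_lim :: "'a \<Rightarrow> real" and X :: "nat \<Rightarrow> 'w \<Rightarrow> 'a"
    and \<rho> C c :: real +
  assumes compact_D: "compact D"
    and measure_D: "measure lebesgue D > 0"
    and R_meas: "R \<in> borel_measurable (lebesgue_on D)"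
    and \<rho>_pos: "\<rho> > 0"
    and R_ge: "\<And>u. u \<in> D \<Longrightarrow> R u \<ge> \<rho>"
    and \<beta>_meas: "\<And>n. \<beta> n \<in> borel_measurable (lebesgue_on D)"
    and \<beta>_pos: "\<And>n u. u \<in> D \<Longrightarrow> \<beta> n u > 0"
    and \<beta>_le: "\<And>n u. u \<in> D \<Longrightarrow> \<beta> n u \<le> C"
    and \<beta>_unif: "uniform_limit D \<beta> \<beta>_lim sequentially"
    and c_pos: "c > 0"
    and \<beta>_lim_ge: "\<And>u. u \<in> D \<Longrightarrow> \<beta>_lim u \<ge> c"
    and X_meas: "\<And>k. k \<ge> 1 \<Longrightarrow> X k \<in> measurable M (restrict_space borel D)"
    and cond: "\<And>k A. A \<in> sets borel \<Longrightarrow>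
      AE \<omega> in M. real_cond_exp M (history M X k) (\<lambda>\<omega>'. indicator A (X (Suc k) \<omega>')) \<omega> =
        (LINT u:A \<inter> D|lebesgue. next_density D R \<beta> ((\<lambda>i. X i \<omega>) ` {1..k}) u)"
begin

definition dens :: "'a set \<Rightarrow> 'a \<Rightarrow> real" where
  "dens Y u = \<beta> (num_neighbours R u Y) u"

text \<open>
  A single \<open>\<beta> n\<close> need not be bounded away from \<open>0\<close> on \<open>D\<close>. The pointwise infimum is nevertheless
  positive, hence so are its integrals over sets of positive measure, which provides the lower
  bounds for the normalizer and for the hitting probabilities.
\<close>

definition floor_dens :: "'a \<Rightarrow> real" where
  "floor_dens u = (INF n. \<beta> n u)"

definition norm_floor :: real where
  "norm_floor = (LINT u:D|lebesgue. floor_dens u)"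

definition hit_prob :: "'a set \<Rightarrow> 'a set \<Rightarrow> real" where
  "hit_prob A Y = (LINT u:A \<inter> D|lebesgue. next_density D R \<beta> Y u)"

definition norm_lim :: real where
  "norm_lim = (LINT u:D|lebesgue. \<beta>_lim u)"

abbreviation vol :: "'a set \<Rightarrow> real" where
  "vol A \<equiv> measure lebesgue (A \<inter> D)"

abbreviation points :: "nat \<Rightarrow> 'w \<Rightarrow> 'a set" where
  "points k \<omega> \<equiv> (\<lambda>i. X i \<omega>) ` {1..k}"

lemma D_lmeasurable [simp]: "D \<in> lmeasurable"
  using compact_D by (rule lmeasurable_compact)

lemma D_lebesgue [simp]: "D \<in> sets lebesgue"
  using D_lmeasurable by (rule fmeasurableD)

lemma C_pos: "C > 0"
proof -
  have "D \<noteq> {}"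
    using measure_D by auto
  then show ?thesis
    using \<beta>_pos \<beta>_le by (meson ex_in_conv less_le_trans)
qed

lemma \<beta>_tendsto: "u \<in> D \<Longrightarrow> (\<lambda>n. \<beta> n u) \<longlonglongrightarrow> \<beta>_lim u"
  by (rule tendsto_uniform_limitI[OF \<beta>_unif])

lemma \<beta>_lim_le: "u \<in> D \<Longrightarrow> \<beta>_lim u \<le> C"
  using LIMSEQ_le_const2[OF \<beta>_tendsto] \<beta>_le by blast

lemma \<beta>_lim_meas: "\<beta>_lim \<in> borel_measurable (lebesgue_on D)"
proof (rule borel_measurable_LIMSEQ_real)
  show "(\<lambda>n. \<beta> n u) \<longlonglongrightarrow> \<beta>_lim u" if "u \<in> space (lebesgue_on D)" for u
    using that by (intro \<beta>_tendsto) simp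
qed (rule \<beta>_meas)

lemma \<beta>_bdd_below: "u \<in> D \<Longrightarrow> bdd_below (range (\<lambda>n. \<beta> n u))"
  using \<beta>_pos by (intro bdd_belowI2[of _ 0]) (simp add: less_imp_le)

lemma floor_dens_le: "u \<in> D \<Longrightarrow> floor_dens u \<le> \<beta> n u"
  unfolding floor_dens_def by (rule cINF_lower[OF \<beta>_bdd_below]) auto

text \<open>At a fixed \<open>u\<close> the values \<open>\<beta> n u\<close> exceed
  \<open>c / 2\<close> from some index on, because their limit is at least \<open>c\<close>. The
  finitely many earlier ones are positive, so a positive minimum bounds the infimum from
  below.\<close>

lemma floor_dens_pos:
  assumes u: "u \<in> D"
  shows "floor_dens u > 0"
proof -
  have "\<forall>\<^sub>F n in sequentially. \<beta> n u > c / 2"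
    using \<beta>_tendsto[OF u] \<beta>_lim_ge[OF u] c_pos by (intro order_tendstoD(1)[of _ "\<beta>_lim u"]) auto
  then obtain N where N: "\<And>n. n \<ge> N \<Longrightarrow> \<beta> n u > c / 2"
    by (auto simp: eventually_sequentially)
  define e where "e = Min (insert (c / 2) ((\<lambda>n. \<beta> n u) ` {..<N}))"
  have "e > 0"
    unfolding e_def using c_pos \<beta>_pos[OF u] by (subst Min_gr_iff) auto
  moreover have "e \<le> \<beta> n u" for n
  proof (cases "n < N")
    case True
    then show ?thesis
      unfolding e_def by (intro Min_le) auto
  next
    case False
    have "e \<le> c / 2"
      unfolding e_def by (intro Min_le) auto
    then show ?thesis
      using N[of n] False by simp
  qed
  then have "e \<le> floor_dens u"
    unfolding floor_dens_def by (intro cINF_greatest) auto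
  ultimately show ?thesis
    by simp
qed

lemma floor_dens_meas: "floor_dens \<in> borel_measurable (lebesgue_on D)"
  unfolding floor_dens_def[abs_def]
  using \<beta>_meas \<beta>_bdd_below by (intro borel_measurable_cINF) auto

lemma dens_bounds:
  assumes "u \<in> D"
  shows "floor_dens u \<le> dens Y u" "dens Y u > 0" "dens Y u \<le> C"
  using assms by (auto simp: dens_def floor_dens_le \<beta>_pos \<beta>_le)

lemma dens_meas:
  assumes "finite Y"
  shows "dens Y \<in> borel_measurable (lebesgue_on D)"
proof -
  have "(\<lambda>u. num_neighbours R u Y) \<in> measurable (lebesgue_on D) (count_space UNIV)"
    using R_meas assms by (intro num_neighbours_measurable) auto
  from measurable_compose_countable[OF \<beta>_meas this] show ?thesis
    unfolding dens_def[abs_def] .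
qed

lemma dens_integrable:
  assumes "finite Y" "A \<in> sets lebesgue"
  shows "set_integrable lebesgue (A \<inter> D) (dens Y)"
proof (rule set_integrable_bounded_on[OF dens_meas[OF assms(1)] D_lmeasurable assms(2)])
  show "\<bar>dens Y u\<bar> \<le> C" if "u \<in> D" for u
    using dens_bounds(2,3)[OF that, of Y] by simp
qed

lemma floor_dens_integrable:
  assumes "A \<in> sets lebesgue"
  shows "set_integrable lebesgue (A \<inter> D) floor_dens"
proof (rule set_integrable_bounded_on[OF floor_dens_meas D_lmeasurable assms])
  show "\<bar>floor_dens u\<bar> \<le> C" if "u \<in> D" for u
    using dens_bounds(1,3)[OF that, of "{}"] floor_dens_pos[OF that] by simp
qed

lemma \<beta>_lim_integrable:
  assumes "A \<in> sets lebesgue"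
  shows "set_integrable lebesgue (A \<inter> D) \<beta>_lim"
proof (rule set_integrable_bounded_on[OF \<beta>_lim_meas D_lmeasurable assms])
  show "\<bar>\<beta>_lim u\<bar> \<le> C" if "u \<in> D" for u
    using \<beta>_lim_ge[OF that] \<beta>_lim_le[OF that] c_pos by simp
qed

lemma D_inter_lmeasurable: "A \<in> sets lebesgue \<Longrightarrow> A \<inter> D \<in> lmeasurable"
  by (metis D_lmeasurable fmeasurable_Int_fmeasurable inf_commute)

lemma integral_floor_dens_pos:
  assumes "A \<in> sets lebesgue" "vol A > 0"
  shows "(LINT u:A \<inter> D|lebesgue. floor_dens u) > 0"
  using assms floor_dens_pos floor_dens_integrable[OF assms(1)]
  by (intro set_integral_positive) auto

lemma norm_floor_pos: "norm_floor > 0"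
  using integral_floor_dens_pos[of UNIV] measure_D by (simp add: norm_floor_def)

lemma integral_dens_bounds:
  assumes Y: "finite Y" and A: "A \<in> sets lebesgue"
  shows "(LINT u:A \<inter> D|lebesgue. floor_dens u) \<le> (LINT u:A \<inter> D|lebesgue. dens Y u)"
    "(LINT u:A \<inter> D|lebesgue. dens Y u) \<le> C * vol A"
    "0 \<le> (LINT u:A \<inter> D|lebesgue. dens Y u)"
proof -
  show "(LINT u:A \<inter> D|lebesgue. floor_dens u) \<le> (LINT u:A \<inter> D|lebesgue. dens Y u)"
    using dens_bounds by (intro set_integral_mono floor_dens_integrable dens_integrable Y A) auto
  have "(LINT u:A \<inter> D|lebesgue. dens Y u) \<le> (LINT u:A \<inter> D|lebesgue. C)"
    using dens_bounds D_inter_lmeasurable[OF A]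
    by (intro set_integral_mono dens_integrable set_integral_const_lmeasurable Y A) auto
  then show "(LINT u:A \<inter> D|lebesgue. dens Y u) \<le> C * vol A"
    using D_inter_lmeasurable[OF A] by (simp add: set_integral_const_lmeasurable)
  show "0 \<le> (LINT u:A \<inter> D|lebesgue. dens Y u)"
    unfolding set_lebesgue_integral_def using dens_bounds(2)
    by (intro integral_nonneg_AE) (auto simp: indicator_def less_imp_le)
qed

lemma normalizer_eq: "normalizer D R \<beta> Y = (LINT u:D|lebesgue. dens Y u)"
  by (simp add: normalizer_def dens_def)

lemma normalizer_bounds:
  assumes "finite Y"
  shows "norm_floor \<le> normalizer D R \<beta> Y" "normalizer D R \<beta> Y \<le> C * measure lebesgue D"
  using integral_dens_bounds[OF assms, of UNIV] by (auto simp: normalizer_eq norm_floor_def)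

lemma norm_floor_le_norm_lim: "norm_floor \<le> norm_lim"
proof -
  have "floor_dens u \<le> \<beta>_lim u" if "u \<in> D" for u
    using \<beta>_tendsto[OF that] floor_dens_le[OF that] by (intro LIMSEQ_le_const) auto
  then show ?thesis
    unfolding norm_floor_def norm_lim_def
    using floor_dens_integrable[of UNIV] \<beta>_lim_integrable[of UNIV]
    by (intro set_integral_mono) auto
qed

lemma hit_prob_eq: "hit_prob A Y = (LINT u:A \<inter> D|lebesgue. dens Y u) / normalizer D R \<beta> Y"
  by (simp add: hit_prob_def next_density_def dens_def)

text \<open>The bounds are uniform in the configuration \<open>Y\<close>. The upper one serves where
  the density may be far from its limit; the lower one makes missing a fixed set geometrically
  unlikely.\<close>

lemma hit_prob_bounds:
  assumes Y: "finite Y" and A: "A \<in> sets lebesgue"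
  shows "0 \<le> hit_prob A Y" "hit_prob A Y \<le> C * vol A / norm_floor"
    "(LINT u:A \<inter> D|lebesgue. floor_dens u) / (C * measure lebesgue D) \<le> hit_prob A Y"
proof -
  note b = integral_dens_bounds[OF Y A] normalizer_bounds[OF Y] norm_floor_pos
  show "0 \<le> hit_prob A Y"
    unfolding hit_prob_eq using b by auto
  show "hit_prob A Y \<le> C * vol A / norm_floor"
    unfolding hit_prob_eq using b C_pos by (intro frac_le) auto
  show "(LINT u:A \<inter> D|lebesgue. floor_dens u) / (C * measure lebesgue D) \<le> hit_prob A Y"
    unfolding hit_prob_eq using b by (intro frac_le) auto
qed

section \<open>From conditional to unconditional probabilities of a hit\<close>

lemma X_borel: "k \<ge> 1 \<Longrightarrow> X k \<in> borel_measurable M"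
  by (rule measurable_restrict_space2_iff[THEN iffD1, THEN conjunct1, OF X_meas])

lemma subalgebra_hist: "subalgebra M (history M X k)"
  by (rule subalgebra_history) (rule X_borel)

lemma history_sets: "H \<in> sets (history M X k) \<Longrightarrow> H \<in> events"
  using subalgebra_hist[of k] unfolding subalgebra_def by blast

lemma hit_event: "A \<in> sets borel \<Longrightarrow> {\<omega> \<in> space M. X (Suc k) \<omega> \<in> A} \<in> events"
  using measurable_sets[OF X_borel, of "Suc k" A] by (simp add: vimage_def Int_def conj_commute)

lemma integrable_indicator_event: "H \<in> events \<Longrightarrow> integrable M (indicat_real H)"
  by (intro integrable_const_bound[where B = 1]) auto

text \<open>
  Working with a version \<open>f\<close> of the conditional probability avoids the question whether
  \<open>\<omega> \<mapsto> hit_prob A (points k \<omega>)\<close> is measurable.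
\<close>

lemma conditional_hit:
  assumes A: "A \<in> sets borel"
  obtains f where "integrable M f" "AE \<omega> in M. f \<omega> = hit_prob A (points k \<omega>)"
    "\<And>H. H \<in> sets (history M X k) \<Longrightarrow>
      prob (H \<inter> {\<omega> \<in> space M. X (Suc k) \<omega> \<in> A}) = (LINT \<omega>|M. indicator H \<omega> * f \<omega>)"
proof -
  interpret hist: finite_measure_subalgebra M "history M X k"
    by unfold_locales (rule subalgebra_hist)
  define h where "h \<omega> = indicat_real A (X (Suc k) \<omega>)" for \<omega>
  have "h \<in> borel_measurable M"
    unfolding h_def using A by (intro measurable_compose[OF X_borel] borel_measurable_indicator) auto
  then have h: "integrable M h"
    by (intro integrable_const_bound[where B = 1]) (auto simp: h_def)
  define f where "f = real_cond_exp M (history M X k) h"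
  show thesis
  proof
    show "integrable M f"
      unfolding f_def using h by (rule hist.real_cond_exp_int)
    show "AE \<omega> in M. f \<omega> = hit_prob A (points k \<omega>)"
      unfolding f_def hit_prob_def h_def using cond[OF A] .
    fix H assume H: "H \<in> sets (history M X k)"
    have "(LINT \<omega>|M. indicator H \<omega> * f \<omega>) = (LINT \<omega>:H|M. h \<omega>)"
      unfolding f_def using hist.real_cond_exp_intA[OF h H] by (simp add: set_lebesgue_integral_def)
    also have "\<dots> = (LINT \<omega>|M. indicator (H \<inter> {\<omega> \<in> space M. X (Suc k) \<omega> \<in> A}) \<omega>)"
      unfolding set_lebesgue_integral_def
      by (intro Bochner_Integration.integral_cong) (auto simp: h_def indicator_def)
    also have "\<dots> = prob (H \<inter> {\<omega> \<in> space M. X (Suc k) \<omega> \<in> A})"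
      using history_sets[OF H] hit_event[OF A] by simp
    finally show "prob (H \<inter> {\<omega> \<in> space M. X (Suc k) \<omega> \<in> A}) = (LINT \<omega>|M. indicator H \<omega> * f \<omega>)" ..
  qed
qed

text \<open>Since \<open>H\<close> belongs to the history, the pointwise lower bound on the
  conditional probability can be integrated over \<open>H\<close>.\<close>

lemma prob_hit_ge:
  assumes A: "A \<in> sets borel" and H: "H \<in> sets (history M X k)"
    and ge: "\<And>Y. finite Y \<Longrightarrow> \<delta> \<le> hit_prob A Y"
  shows "\<delta> * prob H \<le> prob (H \<inter> {\<omega> \<in> space M. X (Suc k) \<omega> \<in> A})"
proof -
  obtain f where f: "integrable M f" "AE \<omega> in M. f \<omega> = hit_prob A (points k \<omega>)"
    "\<And>H. H \<in> sets (history M X k) \<Longrightarrow>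
      prob (H \<inter> {\<omega> \<in> space M. X (Suc k) \<omega> \<in> A}) = (LINT \<omega>|M. indicator H \<omega> * f \<omega>)"
    by (fact conditional_hit[OF A])
  have "\<delta> * prob H = (LINT \<omega>|M. indicator H \<omega> * \<delta>)"
    using history_sets[OF H] by simp
  also have "\<dots> \<le> (LINT \<omega>|M. indicator H \<omega> * f \<omega>)"
  proof (rule integral_mono_AE)
    show "integrable M (\<lambda>\<omega>. indicator H \<omega> * \<delta>)"
      using integrable_indicator_event[OF history_sets[OF H]] by simp
    show "integrable M (\<lambda>\<omega>. indicator H \<omega> * f \<omega>)"
      using integrable_mult_indicator[OF history_sets[OF H] f(1)] by simp
    show "AE \<omega> in M. indicator H \<omega> * \<delta> \<le> indicator H \<omega> * f \<omega>"
      using f(2) by eventually_elim (use ge in \<open>auto simp: indicator_def\<close>)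
  qed
  finally show ?thesis
    using f(3)[OF H] by simp
qed

text \<open>The error is \<open>a\<close> off the exceptional event \<open>E\<close> and
  \<open>a + b\<close> on it, so after integration \<open>b\<close> is paid only with weight
  \<open>prob E\<close>.\<close>

lemma prob_hit_approx:
  assumes A: "A \<in> sets borel" and H: "H \<in> sets (history M X k)" and E: "E \<in> events"
    and le: "\<And>\<omega>. \<omega> \<in> space M \<Longrightarrow> \<bar>hit_prob A (points k \<omega>) - q\<bar> \<le> a + b * indicator E \<omega>"
  shows "\<bar>prob (H \<inter> {\<omega> \<in> space M. X (Suc k) \<omega> \<in> A}) - q * prob H\<bar> \<le> a + b * prob E"
proof -
  obtain f where f: "integrable M f" "AE \<omega> in M. f \<omega> = hit_prob A (points k \<omega>)"
    "\<And>H. H \<in> sets (history M X k) \<Longrightarrow>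
      prob (H \<inter> {\<omega> \<in> space M. X (Suc k) \<omega> \<in> A}) = (LINT \<omega>|M. indicator H \<omega> * f \<omega>)"
    by (fact conditional_hit[OF A])
  have int: "integrable M (\<lambda>\<omega>. indicator H \<omega> * f \<omega>)" "integrable M (\<lambda>\<omega>. indicator H \<omega> * q)"
    using integrable_mult_indicator[OF history_sets[OF H] f(1)]
      integrable_indicator_event[OF history_sets[OF H]] by auto
  have "\<bar>prob (H \<inter> {\<omega> \<in> space M. X (Suc k) \<omega> \<in> A}) - q * prob H\<bar>
      = \<bar>LINT \<omega>|M. indicator H \<omega> * f \<omega> - indicator H \<omega> * q\<bar>"
    using f(3)[OF H] int history_sets[OF H] by (simp add: mult.commute)
  also have "\<dots> \<le> (LINT \<omega>|M. \<bar>indicator H \<omega> * f \<omega> - indicator H \<omega> * q\<bar>)"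
    by (rule integral_abs_bound)
  also have "\<dots> \<le> (LINT \<omega>|M. a + b * indicator E \<omega>)"
  proof (rule integral_mono_AE)
    show "AE \<omega> in M. \<bar>indicator H \<omega> * f \<omega> - indicator H \<omega> * q\<bar> \<le> a + b * indicator E \<omega>"
      using f(2) AE_space
    proof eventually_elim
      case (elim \<omega>)
      then show ?case
        using le[of \<omega>] by (auto simp: indicator_def)
    qed
  qed (use int integrable_indicator_event[OF E] in auto)
  also have "\<dots> = a + b * prob E"
    using integrable_indicator_event[OF E] E by (simp add: prob_space)
  finally show ?thesis .
qed

section \<open>Geometric decay of missing a set, and convergence of the density\<close>

definition missed :: "'a set \<Rightarrow> nat \<Rightarrow> 'w set" where
  "missed P k = {\<omega> \<in> space M. \<forall>i\<in>{1..k}. X i \<omega> \<notin> P}"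

lemma space_history: "space (history M X k) = space M"
  by (simp add: history_def)

lemma hit_history:
  assumes "A \<in> sets borel" "1 \<le> i" "i \<le> k"
  shows "{\<omega> \<in> space M. X i \<omega> \<in> A} \<in> sets (history M X k)"
  using measurable_sets[OF measurable_history[OF assms(2,3), where M = M and X = X] assms(1)]
  by (simp add: vimage_def Int_def conj_commute space_history)

lemma missed_history:
  assumes "P \<in> sets borel"
  shows "missed P k \<in> sets (history M X k)"
proof -
  have "{\<omega> \<in> space (history M X k). X i \<omega> \<notin> P} \<in> sets (history M X k)" if "i \<in> {1..k}" for i
    using hit_history[of "- P" i k] assms that by (simp add: space_history)
  then show ?thesis
    unfolding missed_def space_history[of k, symmetric]
    by (intro sets.sets_Collect_finite_All) auto
qed

text \<open>Whatever the earlier points are, each step hits \<open>P\<close> with conditional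
  probability at least a constant \<open>\<delta> > 0\<close>, so \<open>prob (missed P k)\<close>
  is at most \<open>(1 - \<delta>) ^ k\<close>.\<close>

lemma summable_prob_missed:
  assumes P: "P \<in> sets borel" and vol: "vol P > 0"
  shows "summable (\<lambda>k. prob (missed P k))"
proof -
  define \<delta> where "\<delta> = (LINT u:P \<inter> D|lebesgue. floor_dens u) / (C * measure lebesgue D)"
  have P': "P \<in> sets lebesgue"
    using P by simp
  have "\<delta> > 0"
    unfolding \<delta>_def using integral_floor_dens_pos[OF P' vol] C_pos measure_D by simp
  have hit: "\<delta> * prob H \<le> prob (H \<inter> {\<omega> \<in> space M. X (Suc k) \<omega> \<in> P})"
    if "H \<in> sets (history M X k)" for H k
    using that hit_prob_bounds(3)[OF _ P'] by (intro prob_hit_ge P) (auto simp: \<delta>_def)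
  \<comment> \<open>The first step, with the whole space as event of the trivial history, gives
    \<open>\<delta> \<le> 1\<close>; thus the factor \<open>1 - \<delta>\<close> in the induction
    below is nonnegative.\<close>
  have "space M \<in> sets (history M X 0)"
    using sets.top[of "history M X 0"] by (simp add: space_history)
  from hit[OF this] have "\<delta> \<le> prob (space M \<inter> {\<omega> \<in> space M. X (Suc 0) \<omega> \<in> P})"
    by (simp add: prob_space)
  also have "\<dots> \<le> 1"
    by (rule prob_le_1)
  finally have "\<delta> \<le> 1" .
  have "prob (missed P k) \<le> (1 - \<delta>) ^ k" for k
  proof (induction k)
    case (Suc k)
    define G where "G = missed P k \<inter> {\<omega> \<in> space M. X (Suc k) \<omega> \<in> P}"
    have "missed P (Suc k) = missed P k - G"
      by (auto simp: missed_def G_def atLeastAtMostSuc_conv)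
    moreover have "missed P k \<in> events" "G \<in> events" "G \<subseteq> missed P k"
      using history_sets[OF missed_history[OF P]] hit_event[OF P] by (auto simp: G_def)
    ultimately have "prob (missed P (Suc k)) = prob (missed P k) - prob G"
      by (simp add: finite_measure_Diff)
    also have "\<dots> \<le> (1 - \<delta>) * prob (missed P k)"
      using hit[OF missed_history[OF P, of k]] by (simp add: G_def algebra_simps)
    also have "\<dots> \<le> (1 - \<delta>) * (1 - \<delta>) ^ k"
      using \<open>\<delta> \<le> 1\<close> by (intro mult_left_mono Suc.IH) auto
    finally show ?case
      by simp
  qed simp
  moreover have "summable (\<lambda>k. (1 - \<delta>) ^ k)"
    using \<open>0 < \<delta>\<close> \<open>\<delta> \<le> 1\<close> by (intro summable_geometric) simp
  ultimately show ?thesis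
    by - (rule summable_comparison_test'[where N = 0], assumption, simp)
qed

text \<open>Choose \<open>n\<close> such that \<open>\<beta> j\<close> is within
  \<open>\<epsilon>\<close> of \<open>\<beta>_lim\<close> on \<open>D\<close> for all
  \<open>j \<ge> n\<close>. The exceptional event is that some member of the hitting family for
  \<open>n\<close> is still missed; off it almost every \<open>u\<close> in \<open>D\<close> has at
  least \<open>n\<close> neighbours, since \<open>\<rho> \<le> R u\<close>.\<close>

lemma dens_close_off_summable_events:
  assumes "\<epsilon> > 0"
  obtains E where "\<And>k. E k \<in> events" "summable (\<lambda>k. prob (E k))"
    "\<And>k \<omega>. \<omega> \<in> space M \<Longrightarrow> \<omega> \<notin> E k \<Longrightarrow>
      AE u in lebesgue. u \<in> D \<longrightarrow> \<bar>dens (points k \<omega>) u - \<beta>_lim u\<bar> \<le> \<epsilon>"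
proof -
  have "\<forall>\<^sub>F n in sequentially. \<forall>u\<in>D. dist (\<beta> n u) (\<beta>_lim u) < \<epsilon>"
    using \<beta>_unif assms by (rule uniform_limitD)
  then obtain n where n: "\<And>j u. j \<ge> n \<Longrightarrow> u \<in> D \<Longrightarrow> \<bar>\<beta> j u - \<beta>_lim u\<bar> < \<epsilon>"
    by (auto simp: eventually_sequentially dist_real_def)
  obtain F N where F: "finite F" "\<And>P. P \<in> F \<Longrightarrow> P \<in> sets borel" "\<And>P. P \<in> F \<Longrightarrow> vol P > 0"
    and N: "N \<in> null_sets lebesgue"
    and hits: "\<And>Y u. finite Y \<Longrightarrow> (\<And>P. P \<in> F \<Longrightarrow> P \<inter> Y \<noteq> {}) \<Longrightarrow> u \<in> D - N
      \<Longrightarrow> n \<le> card {y \<in> Y. dist u y \<le> \<rho>}"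
    by (fact finite_hitting_family[OF compact_D \<rho>_pos, of n])
  define E where "E k = (\<Union>P\<in>F. missed P k)" for k
  have missed_events: "missed P k \<in> events" if "P \<in> F" for P k
    by (rule history_sets[OF missed_history[OF F(2)[OF that]]])
  show thesis
  proof
    show "E k \<in> events" for k
      unfolding E_def using F(1) missed_events by (intro sets.finite_UN) auto
    have "summable (\<lambda>k. \<Sum>P\<in>F. prob (missed P k))"
      using F by (intro summable_sum summable_prob_missed) auto
    moreover have "prob (E k) \<le> (\<Sum>P\<in>F. prob (missed P k))" for k
      unfolding E_def using F(1) missed_events
      by (intro finite_measure_subadditive_finite) auto
    ultimately show "summable (\<lambda>k. prob (E k))"
      by - (rule summable_comparison_test'[where N = 0], assumption, simp)
    show "AE u in lebesgue. u \<in> D \<longrightarrow> \<bar>dens (points k \<omega>) u - \<beta>_lim u\<bar> \<le> \<epsilon>"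
      if \<omega>: "\<omega> \<in> space M" "\<omega> \<notin> E k" for k \<omega>
      using AE_not_in[OF N]
    proof eventually_elim
      case (elim u)
      show ?case
      proof
        assume u: "u \<in> D"
        have "P \<inter> points k \<omega> \<noteq> {}" if "P \<in> F" for P
          using \<omega> that by (auto simp: E_def missed_def)
        then have "n \<le> card {y \<in> points k \<omega>. dist u y \<le> \<rho>}"
          using u elim by (intro hits) auto
        also have "\<dots> \<le> num_neighbours R u (points k \<omega>)"
          unfolding num_neighbours_def using R_ge[OF u] by (intro card_mono) auto
        finally show "\<bar>dens (points k \<omega>) u - \<beta>_lim u\<bar> \<le> \<epsilon>"
          unfolding dens_def using n u by (intro less_imp_le) blast
      qed
    qed
  qed
qed

section \<open>Closeness of hitting probabilities to their limit\<close>

text \<open>The numerator is off by at most \<open>2 * \<epsilon> * vol A\<close>, one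
  \<open>\<epsilon>\<close> for the density and one for the variation of \<open>\<beta>_lim\<close>,
  and the normalizer by at most \<open>\<epsilon> * measure lebesgue D\<close>. The factor
  \<open>vol A\<close> is kept because such errors are later summed over \<open>m\<close> steps with
  \<open>vol A\<close> of order \<open>1 / m\<close>.\<close>

lemma hit_prob_close:
  assumes Y: "finite Y" and A: "A \<in> sets lebesgue" and b: "0 \<le> b" "b \<le> C"
    and \<epsilon>: "\<epsilon> \<ge> 0"
    and dens: "AE u in lebesgue. u \<in> D \<longrightarrow> \<bar>dens Y u - \<beta>_lim u\<bar> \<le> \<epsilon>"
    and lim: "\<And>u. u \<in> A \<inter> D \<Longrightarrow> \<bar>\<beta>_lim u - b\<bar> \<le> \<epsilon>"
  shows "\<bar>hit_prob A Y - vol A * b / norm_lim\<bar>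
    \<le> vol A * (\<epsilon> * (2 / norm_floor + C * measure lebesgue D / norm_floor\<^sup>2))"
proof -
  define I where "I = (LINT u:A \<inter> D|lebesgue. dens Y u)"
  define Z where "Z = normalizer D R \<beta> Y"
  have AD: "A \<inter> D \<in> lmeasurable"
    using D_inter_lmeasurable[OF A] .
  have "\<bar>I - (LINT u:A \<inter> D|lebesgue. b)\<bar> \<le> 2 * \<epsilon> * vol A"
    unfolding I_def
  proof (rule set_integral_diff_bound_AE[OF AD dens_integrable[OF Y A]])
    show "set_integrable lebesgue (A \<inter> D) (\<lambda>_. b)"
      using AD by (rule set_integral_const_lmeasurable)
    show "AE u in lebesgue. u \<in> A \<inter> D \<longrightarrow> \<bar>dens Y u - b\<bar> \<le> 2 * \<epsilon>"
      using dens
    proof eventually_elim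
      case (elim u)
      then show ?case
        using lim[of u] by auto
    qed
  qed
  then have I: "\<bar>I - vol A * b\<bar> \<le> vol A * (2 * \<epsilon>)"
    using AD by (simp add: set_integral_const_lmeasurable mult.commute)
  have Z: "\<bar>Z - norm_lim\<bar> \<le> \<epsilon> * measure lebesgue D"
    unfolding Z_def normalizer_eq norm_lim_def
    using dens dens_integrable[OF Y, of UNIV] \<beta>_lim_integrable[of UNIV]
    by (intro set_integral_diff_bound_AE) auto
  have pos: "0 < norm_floor" "norm_floor \<le> Z" "norm_floor \<le> norm_lim"
    using norm_floor_pos normalizer_bounds(1)[OF Y] norm_floor_le_norm_lim by (auto simp: Z_def)
  \<comment> \<open>The difference of quotients splits into the error of the numerator and that of
    the normalizer; \<open>norm_floor\<close> bounds both \<open>Z\<close> and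
    \<open>norm_lim\<close> from below.\<close>
  have "hit_prob A Y - vol A * b / norm_lim
      = (I - vol A * b) / Z + vol A * b * (norm_lim - Z) / (Z * norm_lim)"
    using pos by (simp add: hit_prob_eq I_def Z_def field_simps)
  also have "\<bar>\<dots>\<bar> \<le> \<bar>(I - vol A * b) / Z\<bar> + \<bar>vol A * b * (norm_lim - Z) / (Z * norm_lim)\<bar>"
    by (rule abs_triangle_ineq)
  also have "\<bar>(I - vol A * b) / Z\<bar> \<le> vol A * (2 * \<epsilon>) / norm_floor"
    using I pos \<epsilon> by (simp add: abs_divide) (intro frac_le, auto)
  also have "\<bar>vol A * b * (norm_lim - Z) / (Z * norm_lim)\<bar>
      \<le> vol A * C * (\<epsilon> * measure lebesgue D) / (norm_floor * norm_floor)"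
  proof -
    have "\<bar>vol A * b * (norm_lim - Z)\<bar> \<le> vol A * C * (\<epsilon> * measure lebesgue D)"
      unfolding abs_mult using Z b by (intro mult_mono) (auto simp: abs_minus_commute)
    moreover have "norm_floor * norm_floor \<le> \<bar>Z * norm_lim\<bar>"
      unfolding abs_mult using pos by (intro mult_mono) auto
    ultimately show ?thesis
      unfolding abs_divide using pos C_pos \<epsilon> by (intro frac_le) auto
  qed
  finally show ?thesis
    by (simp add: algebra_simps power2_eq_square)
qed

section \<open>Comparison of the counting variable with binomial and Poisson laws\<close>

definition count :: "'a set \<Rightarrow> nat \<Rightarrow> 'w \<Rightarrow> nat" where
  "count A k \<omega> = card {i \<in> {1..k}. X i \<omega> \<in> A}"

lemma count_Suc: "count A (Suc k) \<omega> = count A k \<omega> + (if X (Suc k) \<omega> \<in> A then 1 else 0)"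
proof -
  have "{i \<in> {1..Suc k}. X i \<omega> \<in> A}
      = (if X (Suc k) \<omega> \<in> A then insert (Suc k) {i \<in> {1..k}. X i \<omega> \<in> A} else {i \<in> {1..k}. X i \<omega> \<in> A})"
    by (auto simp: le_Suc_eq)
  then show ?thesis
    by (simp add: count_def)
qed

lemma count_measurable:
  assumes A: "A \<in> sets borel"
  shows "count A k \<in> measurable (history M X k) (count_space UNIV)"
proof -
  have "count A k = (\<lambda>\<omega>. \<Sum>i\<in>{1..k}. if X i \<omega> \<in> A then 1 else 0)"
    by (auto simp: count_def sum.If_cases Int_def)
  moreover have "(\<lambda>\<omega>. \<Sum>i\<in>{1..k}. if X i \<omega> \<in> A then 1 else (0::nat))
      \<in> measurable (history M X k) (count_space UNIV)"
    using A by (intro measurable_sum_nat measurable_If hit_history[unfolded space_history[of k, symmetric]]) auto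
  ultimately show ?thesis
    by simp
qed

text \<open>The value \<open>Suc j\<close> arises from \<open>Suc j\<close> without a new hit or
  from \<open>j\<close> with one. Replacing the two hit probabilities by \<open>q\<close> costs at
  most \<open>a + b * prob (E k)\<close> each, whence the factor \<open>2\<close>.\<close>

lemma prob_count_approx:
  assumes A: "A \<in> sets borel" and q: "0 \<le> q" "q \<le> 1" and ab: "0 \<le> a" "0 \<le> b"
    and E: "\<And>k. E k \<in> events"
    and le: "\<And>k \<omega>. \<omega> \<in> space M \<Longrightarrow> \<bar>hit_prob A (points k \<omega>) - q\<bar> \<le> a + b * indicator (E k) \<omega>"
  shows "\<bar>prob {\<omega> \<in> space M. count A m \<omega> = j} - real (m choose j) * q ^ j * (1 - q) ^ (m - j)\<bar>
    \<le> 2 * (real m * a + b * (\<Sum>k<m. prob (E k)))"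
proof -
  define H where "H k j = {\<omega> \<in> space M. count A k \<omega> = j}" for k j
  define G where "G k = {\<omega> \<in> space M. X (Suc k) \<omega> \<in> A}" for k
  have H_hist: "H k j \<in> sets (history M X k)" for k j
    using measurable_sets[OF count_measurable[OF A], of "{j}" k]
    by (simp add: H_def vimage_def Int_def conj_commute space_history)
  have H: "H k j \<in> events" for k j
    using H_hist by (rule history_sets)
  have G: "G k \<in> events" for k
    unfolding G_def using A by (rule hit_event)
  have near: "\<bar>prob (H k j \<inter> G k) - q * prob (H k j)\<bar> \<le> a + b * prob (E k)" for k j
    unfolding G_def using le by (intro prob_hit_approx A H_hist E)
  have split: "prob (H k j - G k) = prob (H k j) - prob (H k j \<inter> G k)" for k j
    using H G by (rule finite_measure_Diff')
  have nonneg: "0 \<le> a + b * prob (E k)" for k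
    using ab by simp
  have "\<bar>prob (H m j) - real (m choose j) * q ^ j * (1 - q) ^ (m - j)\<bar>
      \<le> (\<Sum>k<m. 2 * (a + b * prob (E k)))"
  proof (rule perturbed_binomial_recursion[OF q])
    show "prob (H 0 j) = (if j = 0 then 1 else 0)" for j
      by (simp add: H_def count_def prob_space)
  next
    fix k
    have "H (Suc k) 0 = H k 0 - G k"
      by (auto simp: H_def G_def count_Suc)
    then have "prob (H (Suc k) 0) = prob (H k 0) - prob (H k 0 \<inter> G k)"
      by (simp add: split)
    then have "\<bar>prob (H (Suc k) 0) - (1 - q) * prob (H k 0)\<bar> = \<bar>prob (H k 0 \<inter> G k) - q * prob (H k 0)\<bar>"
      by (simp add: algebra_simps)
    \<comment> \<open>The value \<open>0\<close> has only one source of error; doubling its bound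
      gives the same defect for all values.\<close>
    also have "\<dots> \<le> 2 * (a + b * prob (E k))"
      by (rule order.trans[OF near[of k 0]]) (use nonneg[of k] in simp)
    finally show "\<bar>prob (H (Suc k) 0) - (1 - q) * prob (H k 0)\<bar> \<le> 2 * (a + b * prob (E k))" .
  next
    fix k j
    have "H (Suc k) (Suc j) = (H k (Suc j) - G k) \<union> (H k j \<inter> G k)"
      by (auto simp: H_def G_def count_Suc split: if_splits)
    moreover have "(H k (Suc j) - G k) \<inter> (H k j \<inter> G k) = {}"
      by auto
    ultimately have "prob (H (Suc k) (Suc j)) = prob (H k (Suc j) - G k) + prob (H k j \<inter> G k)"
      using H G by (simp add: finite_measure_Union)
    then have "prob (H (Suc k) (Suc j)) - ((1 - q) * prob (H k (Suc j)) + q * prob (H k j))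
        = (prob (H k j \<inter> G k) - q * prob (H k j))
          - (prob (H k (Suc j) \<inter> G k) - q * prob (H k (Suc j)))"
      by (simp add: split algebra_simps)
    then have "\<bar>prob (H (Suc k) (Suc j)) - ((1 - q) * prob (H k (Suc j)) + q * prob (H k j))\<bar>
        = \<bar>(prob (H k j \<inter> G k) - q * prob (H k j))
          - (prob (H k (Suc j) \<inter> G k) - q * prob (H k (Suc j)))\<bar>"
      by (rule arg_cong)
    also have "\<dots> \<le> \<bar>prob (H k j \<inter> G k) - q * prob (H k j)\<bar>
        + \<bar>prob (H k (Suc j) \<inter> G k) - q * prob (H k (Suc j))\<bar>"
      by (rule abs_triangle_ineq4)
    also have "\<dots> \<le> 2 * (a + b * prob (E k))"
      unfolding mult_2 by (rule add_mono[OF near near])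
    finally show "\<bar>prob (H (Suc k) (Suc j)) - ((1 - q) * prob (H k (Suc j)) + q * prob (H k j))\<bar>
        \<le> 2 * (a + b * prob (E k))" .
  qed
  also have "(\<Sum>k<m. 2 * (a + b * prob (E k))) = 2 * (real m * a + b * (\<Sum>k<m. prob (E k)))"
    by (simp add: sum.distrib sum_distrib_left distrib_left)
  finally show ?thesis
    by (simp add: H_def)
qed

text \<open>Each hit probability is compared with
  \<open>vol (A m) * \<beta>_lim x / norm_lim\<close>, and this with \<open>l / real m\<close>. Over
  \<open>m\<close> steps the first error adds up to about \<open>v * \<epsilon> * L\<close> off the
  bad events, which add at most a constant times \<open>vol (A m)\<close> because their
  probabilities are summable.\<close>

lemma count_tendsto_poisson:
  fixes A :: "nat \<Rightarrow> 'a set" and x :: 'a and v :: real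
  defines "l \<equiv> v * \<beta>_lim x / norm_lim"
  assumes cont: "continuous_on D \<beta>_lim" and x: "x \<in> D" and v: "v > 0"
    and A: "\<And>m. A m \<in> sets borel"
    and shrink: "\<And>e. e > 0 \<Longrightarrow> \<forall>\<^sub>F m in sequentially. A m \<subseteq> ball x e"
    and vol: "(\<lambda>m. real m * vol (A m)) \<longlonglongrightarrow> v"
  shows "(\<lambda>m. prob {\<omega> \<in> space M. count (A m) m \<omega> = j}) \<longlonglongrightarrow> pmf (poisson_pmf l) j"
proof -
  define L where "L = 2 / norm_floor + C * measure lebesgue D / norm_floor\<^sup>2"
  define binom where "binom m = real (m choose j) * (l / real m) ^ j * (1 - l / real m) ^ (m - j)" for m
  define P where "P m = prob {\<omega> \<in> space M. count (A m) m \<omega> = j}" for m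
  \<comment> \<open>The gap between the limiting hit probability of \<open>A m\<close> and
    \<open>l / real m\<close>; it is small enough to vanish even when multiplied by
    \<open>m\<close>.\<close>
  define s where "s m = \<bar>vol (A m) * \<beta>_lim x / norm_lim - l / real m\<bar>" for m
  have bx: "0 < \<beta>_lim x" "\<beta>_lim x \<le> C"
    using \<beta>_lim_ge[OF x] \<beta>_lim_le[OF x] c_pos by auto
  have pos: "0 < norm_floor" "norm_floor \<le> norm_lim"
    using norm_floor_pos norm_floor_le_norm_lim by auto
  have "l > 0"
    using v bx pos by (simp add: l_def)
  have "L \<ge> 0"
    using C_pos pos by (simp add: L_def)
  have A': "A m \<in> sets lebesgue" for m
    using A[of m] by simp
  have s_lim: "(\<lambda>m. real m * s m) \<longlonglongrightarrow> 0"
  proof -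
    have "(\<lambda>m. \<bar>(real m * vol (A m)) * \<beta>_lim x / norm_lim - l\<bar>) \<longlonglongrightarrow> \<bar>v * \<beta>_lim x / norm_lim - l\<bar>"
      using pos by (intro tendsto_intros vol) auto
    then have "(\<lambda>m. \<bar>(real m * vol (A m)) * \<beta>_lim x / norm_lim - l\<bar>) \<longlonglongrightarrow> 0"
      by (simp add: l_def)
    moreover have "\<forall>\<^sub>F m in sequentially.
        \<bar>(real m * vol (A m)) * \<beta>_lim x / norm_lim - l\<bar> = real m * s m"
      using eventually_gt_at_top[of 0]
    proof eventually_elim
      case (elim m)
      then have "real m * s m = \<bar>real m * (vol (A m) * \<beta>_lim x / norm_lim - l / real m)\<bar>"
        by (simp add: s_def abs_mult)
      also have "real m * (vol (A m) * \<beta>_lim x / norm_lim - l / real m)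
          = (real m * vol (A m)) * \<beta>_lim x / norm_lim - l"
        using elim by (simp add: right_diff_distrib)
      finally show ?case ..
    qed
    ultimately show ?thesis
      by (rule Lim_transform_eventually)
  qed
  have vol_lim: "(\<lambda>m. vol (A m)) \<longlonglongrightarrow> 0"
  proof -
    have "(\<lambda>m. (real m * vol (A m)) * (1 / real m)) \<longlonglongrightarrow> v * 0"
      by (intro tendsto_mult vol lim_const_over_n)
    moreover have "\<forall>\<^sub>F m in sequentially. (real m * vol (A m)) * (1 / real m) = vol (A m)"
      using eventually_gt_at_top[of 0] by eventually_elim simp
    ultimately show ?thesis
      by (auto intro: Lim_transform_eventually)
  qed
  have "(\<lambda>m. P m - binom m) \<longlonglongrightarrow> 0"
  proof (rule tendstoI)
    fix e :: real assume "e > 0"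
    \<comment> \<open>This \<open>\<epsilon>\<close> makes
      \<open>2 * (v * (\<epsilon> * L))\<close>, the limit of \<open>bound\<close>, strictly smaller
      than \<open>e\<close>; the \<open>+ 1\<close> yields the strictness.\<close>
    define \<epsilon> where "\<epsilon> = e / (2 * (v * L + 1))"
    have den: "v * L + 1 > 0"
      using v \<open>L \<ge> 0\<close> by (simp add: add_nonneg_pos)
    have \<epsilon>: "\<epsilon> > 0"
      using \<open>e > 0\<close> den by (simp add: \<epsilon>_def)
    have "2 * (v * (\<epsilon> * L)) = e * (v * L / (v * L + 1))"
      using den by (simp add: \<epsilon>_def divide_eq_eq) (simp add: field_simps)
    also have "\<dots> < e * 1"
      using den \<open>e > 0\<close> by (intro mult_strict_left_mono) auto
    finally have \<epsilon>_small: "2 * (v * (\<epsilon> * L)) < e"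
      by simp
    obtain E where E: "\<And>k. E k \<in> events" "summable (\<lambda>k. prob (E k))"
      and close: "\<And>k \<omega>. \<omega> \<in> space M \<Longrightarrow> \<omega> \<notin> E k \<Longrightarrow>
        AE u in lebesgue. u \<in> D \<longrightarrow> \<bar>dens (points k \<omega>) u - \<beta>_lim u\<bar> \<le> \<epsilon>"
      by (fact dens_close_off_summable_events[OF \<epsilon>])
    define T where "T = (\<Sum>k. prob (E k))"
    obtain d where d: "d > 0" "\<And>u. u \<in> D \<Longrightarrow> dist u x < d \<Longrightarrow> \<bar>\<beta>_lim u - \<beta>_lim x\<bar> < \<epsilon>"
      using cont[unfolded continuous_on_iff] x \<epsilon> unfolding dist_real_def by metis
    define bound where
      "bound m = 2 * (real m * vol (A m) * (\<epsilon> * L) + real m * s m + vol (A m) * (2 * C / norm_floor) * T)" for m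
    have "\<forall>\<^sub>F m in sequentially. \<bar>P m - binom m\<bar> \<le> bound m"
      \<comment> \<open>For such \<open>m\<close> the quotient \<open>l / real m\<close> is a
        probability, and \<open>A m\<close> lies in a ball where \<open>\<beta>_lim\<close> differs
        from \<open>\<beta>_lim x\<close> by less than \<open>\<epsilon>\<close> on
        \<open>D\<close>.\<close>
      using shrink[OF d(1)] eventually_gt_at_top[of "nat \<lceil>l\<rceil>"]
    proof eventually_elim
      case (elim m)
      then have m: "l < real m"
        by linarith
      define a where "a = vol (A m) * (\<epsilon> * L) + s m"
      \<comment> \<open>On a bad event both compared quantities lie between \<open>0\<close> and
        \<open>C * vol (A m) / norm_floor\<close>; \<open>b\<close> is the sum of the two upper
        bounds.\<close>
      define b where "b = vol (A m) * (2 * C / norm_floor)"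
      have ab: "0 \<le> a" "0 \<le> b"
        using \<epsilon> \<open>L \<ge> 0\<close> C_pos pos by (auto simp: a_def b_def s_def)
      have near: "\<bar>hit_prob (A m) (points k \<omega>) - vol (A m) * \<beta>_lim x / norm_lim\<bar>
          \<le> vol (A m) * (\<epsilon> * L) + b * indicator (E k) \<omega>" if \<omega>: "\<omega> \<in> space M" for k \<omega>
      proof (cases "\<omega> \<in> E k")
        case False
        have "\<bar>\<beta>_lim u - \<beta>_lim x\<bar> \<le> \<epsilon>" if "u \<in> A m \<inter> D" for u
          using that elim(1) d(2)[of u] by (auto simp: dist_commute subset_eq intro!: less_imp_le)
        then show ?thesis
          using False \<epsilon> hit_prob_close[OF _ A' less_imp_le[OF bx(1)] bx(2) _ close[OF \<omega> False]] by (simp add: L_def)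
      next
        case True
        have "0 \<le> hit_prob (A m) (points k \<omega>)" "hit_prob (A m) (points k \<omega>) \<le> C * vol (A m) / norm_floor"
          using hit_prob_bounds[OF _ A'] by auto
        moreover have "0 \<le> vol (A m) * \<beta>_lim x / norm_lim"
          using bx pos by simp
        moreover have "vol (A m) * \<beta>_lim x / norm_lim \<le> vol (A m) * C / norm_floor"
          using bx pos by (intro frac_le mult_left_mono mult_nonneg_nonneg) auto
        moreover have "b = C * vol (A m) / norm_floor + vol (A m) * C / norm_floor"
          by (simp add: b_def)
        moreover have "0 \<le> vol (A m) * (\<epsilon> * L)"
          using \<epsilon> \<open>L \<ge> 0\<close> by simp
        ultimately have "\<bar>hit_prob (A m) (points k \<omega>) - vol (A m) * \<beta>_lim x / norm_lim\<bar>
            \<le> vol (A m) * (\<epsilon> * L) + b"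
          by linarith
        then show ?thesis
          using True by simp
      qed
      have "\<bar>hit_prob (A m) (points k \<omega>) - l / real m\<bar> \<le> a + b * indicator (E k) \<omega>"
        if "\<omega> \<in> space M" for k \<omega>
        using near[OF that, of k] unfolding a_def s_def by linarith
      then have "\<bar>P m - binom m\<bar> \<le> 2 * (real m * a + b * (\<Sum>k<m. prob (E k)))"
        unfolding P_def binom_def using m \<open>l > 0\<close>
        by (intro prob_count_approx A ab E(1)) (auto simp: divide_le_eq)
      \<comment> \<open>The bad events do not depend on \<open>m\<close>, so the sum
        \<open>T\<close> of their probabilities is a constant, while \<open>b\<close> tends to
        \<open>0\<close>.\<close>
      also have "\<dots> \<le> 2 * (real m * a + b * T)"
        unfolding T_def using ab E(2) by (intro mult_left_mono add_left_mono sum_le_suminf) auto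
      also have "\<dots> = bound m"
        by (simp add: bound_def a_def b_def algebra_simps)
      finally show ?case .
    qed
    moreover have "bound \<longlonglongrightarrow> 2 * (v * (\<epsilon> * L) + 0 + 0 * (2 * C / norm_floor) * T)"
      unfolding bound_def by (intro tendsto_intros vol s_lim vol_lim)
    then have "\<forall>\<^sub>F m in sequentially. bound m < e"
      using \<epsilon>_small by (intro order_tendstoD(2)) auto
    ultimately show "\<forall>\<^sub>F m in sequentially. dist (P m - binom m) 0 < e"
      by eventually_elim simp
  qed
  moreover have "binom \<longlonglongrightarrow> l ^ j / fact j * exp (- l)"
    unfolding binom_def by (rule poisson_limit_of_binomial)
  ultimately have "(\<lambda>m. (P m - binom m) + binom m) \<longlonglongrightarrow> 0 + l ^ j / fact j * exp (- l)"
    by (rule tendsto_add)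
  then show ?thesis
    using \<open>l > 0\<close> by (simp add: P_def)
qed

end

section \<open>Volumes of shrinking balls at a density point\<close>

text \<open>The exponent \<open>- 1 / real DIM('a)\<close> cancels the dimension, so for
  \<open>m > 0\<close> the whole ball has volume exactly the claimed limit divided by
  \<open>m\<close>. What remains is the density ratio, which tends to \<open>1\<close>.\<close>

lemma density_point_scaled_volume:
  fixes x :: "'a::euclidean_space"
  assumes "density_point D x" and "r > 0"
  shows "(\<lambda>m. real m * measure lebesgue (cball x (r * real m powr (- 1 / real DIM('a))) \<inter> D))
    \<longlonglongrightarrow> r ^ DIM('a) * measure lborel (cball (0::'a) 1)"
proof -
  define \<rho> where "\<rho> m = r * real m powr (- 1 / real DIM('a))" for m :: nat
  have pos: "\<rho> m > 0" if "m > 0" for m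
    using that assms(2) by (simp add: \<rho>_def)
  have "\<rho> \<longlonglongrightarrow> r * 0"
    unfolding \<rho>_def by (intro tendsto_mult tendsto_const tendsto_neg_powr filterlim_real_sequentially)
      (simp add: divide_neg_pos)
  \<comment> \<open>Positivity lets the radii approach \<open>0\<close> from the right, as
    \<open>density_point\<close> requires; at \<open>m = 0\<close> the radius is \<open>0\<close>,
    because \<open>0 powr y = 0\<close>.\<close>
  moreover have "\<forall>\<^sub>F m in sequentially. \<rho> m > 0"
    using eventually_gt_at_top[of 0] by eventually_elim (rule pos)
  ultimately have "filterlim \<rho> (at_right 0) sequentially"
    by (auto simp: filterlim_at elim: eventually_mono)
  then have "(\<lambda>m. measure lebesgue (D \<inter> cball x (\<rho> m)) / measure lebesgue (cball x (\<rho> m))) \<longlonglongrightarrow> 1"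
    using assms(1) unfolding density_point_def by (rule filterlim_compose[rotated])
  then have lim: "(\<lambda>m. r ^ DIM('a) * measure lborel (cball (0::'a) 1)
      * (measure lebesgue (D \<inter> cball x (\<rho> m)) / measure lebesgue (cball x (\<rho> m))))
    \<longlonglongrightarrow> r ^ DIM('a) * measure lborel (cball (0::'a) 1) * 1"
    by (intro tendsto_mult tendsto_const)
  have "\<forall>\<^sub>F m in sequentially. r ^ DIM('a) * measure lborel (cball (0::'a) 1)
      * (measure lebesgue (D \<inter> cball x (\<rho> m)) / measure lebesgue (cball x (\<rho> m)))
    = real m * measure lebesgue (cball x (\<rho> m) \<inter> D)"
    using eventually_gt_at_top[of 0]
  proof eventually_elim
    case (elim m)
    have "\<rho> m ^ DIM('a) = r ^ DIM('a) * (real m powr (- 1 / real DIM('a))) ^ DIM('a)"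
      unfolding \<rho>_def by (rule power_mult_distrib)
    also have "(real m powr (- 1 / real DIM('a))) ^ DIM('a) = real m powr (- 1)"
      using elim by (simp add: powr_realpow[symmetric] powr_powr)
    also have "\<dots> = 1 / real m"
      using elim by (simp add: powr_minus_divide)
    finally have "measure lebesgue (cball x (\<rho> m)) = measure lborel (cball (0::'a) 1) * (r ^ DIM('a) / real m)"
      using content_cball[of "\<rho> m" x] content_cball[of 1 "0::'a"] pos[OF elim] by simp
    moreover have "measure lborel (cball (0::'a) 1) > 0"
      by simp
    ultimately show ?case
      using elim assms(2) by (simp add: Int_commute)
  qed
  then show ?thesis
    using lim by (auto simp: \<rho>_def intro: Lim_transform_eventually)
qed

lemma eventually_cball_subset_ball:
  fixes x :: "'a::metric_space"
  assumes "p < 0" "e > 0"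
  shows "\<forall>\<^sub>F m in sequentially. cball x (r * real m powr p) \<subseteq> ball x e"
proof -
  have "(\<lambda>m. r * real m powr p) \<longlonglongrightarrow> r * 0"
    by (intro tendsto_mult tendsto_const tendsto_neg_powr filterlim_real_sequentially assms)
  then have "\<forall>\<^sub>F m in sequentially. r * real m powr p < e"
    using assms(2) by (intro order_tendstoD(2)) auto
  then show ?thesis
    by eventually_elim auto
qed

section \<open>The Poisson limit for balls around \<open>x\<close>\<close>

theorem theorem1p2:
  fixes D :: "'a::euclidean_space set"
    and R :: "'a \<Rightarrow> real"
    and \<beta> :: "nat \<Rightarrow> 'a \<Rightarrow> real"
    and \<beta>_lim :: "'a \<Rightarrow> real"
    and M :: "'w measure"
    and X :: "nat \<Rightarrow> 'w \<Rightarrow> 'a"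
    and x :: 'a
    and r :: real
  assumes "compact D"
    and "emeasure lebesgue D > 0"
    and "R \<in> borel_measurable (lebesgue_on D)"
    and "\<And>u. u \<in> D \<Longrightarrow> R u \<ge> 0"
    and "(INF u\<in>D. R u) > 0"
    and "\<And>n. \<beta> n \<in> bounded_measurable_on D"
    and "\<And>n u. u \<in> D \<Longrightarrow> \<beta> n u > 0"
    and "\<exists>C. \<forall>n. \<forall>u\<in>D. \<beta> n u \<le> C"
    and "uniform_limit D \<beta> \<beta>_lim sequentially"
    and "\<beta>_lim \<in> bounded_measurable_on D"
    and "(INF u\<in>D. \<beta>_lim u) > 0"
    and "continuous_on D \<beta>_lim"
    and "sequential_points M D R \<beta> X"
    and "x \<in> D"
    and "density_point D x"
    and "r > 0"
  shows "weak_conv_m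
           (\<lambda>m. distr M borel (\<lambda>\<omega>. real (count_in_ball X x r m \<omega>)))
           (distr (measure_pmf (poisson_pmf
               (r ^ DIM('a) * measure lborel (cball (0::'a) 1) * \<beta>_lim x / (LINT u:D|lebesgue. \<beta>_lim u))))
             borel real)"
proof -
  have prob: "prob_space M" and X: "\<And>k. k \<ge> 1 \<Longrightarrow> X k \<in> measurable M (restrict_space borel D)"
    and cond: "\<And>k A. A \<in> sets borel \<Longrightarrow>
      AE \<omega> in M. real_cond_exp M (history M X k) (\<lambda>\<omega>'. indicator A (X (Suc k) \<omega>')) \<omega> =
        (LINT u:A \<inter> D|lebesgue. next_density D R \<beta> ((\<lambda>i. X i \<omega>) ` {1..k}) u)"
    using assms(13) unfolding sequential_points_def by auto
  obtain C where C: "\<And>n u. u \<in> D \<Longrightarrow> \<beta> n u \<le> C"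
    using assms(8) by blast
  \<comment> \<open>An \<open>INF\<close> of reals is a lower bound of its members once they are
    bounded below; this comes from boundedness for \<open>\<beta>_lim\<close> and from nonnegativity
    for \<open>R\<close>.\<close>
  have "bdd_below (\<beta>_lim ` D)"
    using assms(10) by (simp add: bounded_measurable_on_def bounded_imp_bdd_below)
  then have \<beta>_lim_ge: "(INF u\<in>D. \<beta>_lim u) \<le> \<beta>_lim u" if "u \<in> D" for u
    using that by (rule cINF_lower)
  have "bdd_below (R ` D)"
    using assms(4) by (intro bdd_belowI2[of _ 0])
  then have R_ge: "(INF u\<in>D. R u) \<le> R u" if "u \<in> D" for u
    using that by (rule cINF_lower)
  have "D \<in> lmeasurable"
    using assms(1) by (rule lmeasurable_compact)
  then have vol_D: "measure lebesgue D > 0"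
    using assms(2) by (simp add: emeasure_eq_measure2)
  interpret prob_space M
    by (rule prob)
  interpret growing_points M D R \<beta> \<beta>_lim X "INF u\<in>D. R u" C "INF u\<in>D. \<beta>_lim u"
  proof unfold_locales
    show "\<beta> n \<in> borel_measurable (lebesgue_on D)" for n
      using assms(6) by (simp add: bounded_measurable_on_def)
  qed (fact assms vol_D R_ge C \<beta>_lim_ge X cond)+
  define p where "p = - 1 / real DIM('a)"
  have "p < 0"
    by (simp add: p_def divide_neg_pos)
  define B where "B m = cball x (r * real m powr p)" for m :: nat
  define v where "v = r ^ DIM('a) * measure lborel (cball (0::'a) 1)"
  have B: "B m \<in> sets borel" for m
    by (simp add: B_def)
  have count_eq: "count_in_ball X x r m \<omega> = count (B m) m \<omega>" for m \<omega>
    by (simp add: count_in_ball_def count_def B_def p_def)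
  have "(\<lambda>m. prob {\<omega> \<in> space M. count (B m) m \<omega> = j})
      \<longlonglongrightarrow> pmf (poisson_pmf (v * \<beta>_lim x / norm_lim)) j" for j
  proof (rule count_tendsto_poisson[OF assms(12,14) _ B])
    show "v > 0"
      using assms(16) by (simp add: v_def)
    show "\<forall>\<^sub>F m in sequentially. B m \<subseteq> ball x e" if "e > 0" for e
      unfolding B_def using \<open>p < 0\<close> that by (rule eventually_cball_subset_ball)
    show "(\<lambda>m. real m * measure lebesgue (B m \<inter> D)) \<longlonglongrightarrow> v"
      unfolding B_def v_def p_def using assms(15,16) by (rule density_point_scaled_volume)
  qed
  moreover have "count (B m) m \<in> measurable M (count_space UNIV)" for m
    using measurable_from_subalg[OF subalgebra_hist count_measurable[OF B]] .
  ultimately have "weak_conv_m (\<lambda>m. distr M borel (\<lambda>\<omega>. real (count (B m) m \<omega>)))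
      (distr (measure_pmf (poisson_pmf (v * \<beta>_lim x / norm_lim))) borel real)"
    by (intro weak_conv_m_of_nat_pointwise prob)
  then show ?thesis
    unfolding count_eq v_def norm_lim_def .
qed

end
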